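(* Let $q>1$ be an integer, let $G_1,\ldots,G_k$ ($k\ge 1$) be pairwise nonisomorphic connected finite simple graphs, each with at least two vertices, and let $\alpha$ be a fixed positive irrational number. Let $I=\{i\in\{1,\ldots,k\}: m(G_i)<\alpha^{-1}\}$ and $J=\{1,\ldots,k\}\setminus I$. Let $p=p(n)=n^{-\alpha}$, for each $i$ let $\xi_i\in\mathbf Z_q$ be $N(G_{n,p},G_i)$ reduced modulo $q$, and let $\xi=(\xi_1,\ldots,\xi_k)$. Then for every $a=(a_1,\ldots,a_k)\in\mathbf Z_q^k$, as $n\to\infty$, $$\Pr(\xi=a)\to\begin{cases} q^{-|I|} & \text{if } a_j=0 \text{ for all } j\in J,\\ 0 & \text{otherwise.}\end{cases}$$
   Context: $G_{n,p}$ is the binomial (Erdős–Rényi) random graph on $n$ labeled vertices, in which each potential edge is present independently with probability $p$. For graphs $G,H$, $N(G,H)$ is the number of unlabeled copies of $H$ in $G$, i.e. the number of subgraphs (not necessarily induced) of $G$ isomorphic to $H$ (for example $N(K_r,K_s)=\binom{r}{s}$). For a graph $H$, $v_H$ and $e_H$ denote its numbers of vertices and edges; $\rho(H)=e_H/v_H$ and $m(H)=\max\{\rho(H'):H'\subseteq H,\ v_{H'}>0\}$. *)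

theory Defs
  imports "HOL-Probability.Probability" "HOL-Library.Ramsey"
begin

type_synonym 'a graph = "'a set \<times> 'a set set"

abbreviation verts :: "'a graph \<Rightarrow> 'a set" where
  "verts \<equiv> fst"

abbreviation edges :: "'a graph \<Rightarrow> 'a set set" where
  "edges \<equiv> snd"

definition finite_simple_graph :: "'a graph \<Rightarrow> bool" where
  "finite_simple_graph G \<longleftrightarrow> finite (verts G) \<and> edges G \<subseteq> [verts G]\<^bsup>2\<^esup>"

definition connected_graph :: "'a graph \<Rightarrow> bool" where
  "connected_graph G \<longleftrightarrow> verts G \<noteq> {} \<and>
     (\<forall>u\<in>verts G. \<forall>v\<in>verts G. (u, v) \<in> {(x, y). {x, y} \<in> edges G}\<^sup>*)"

text \<open>Subgraphs are not necessarily induced or spanning, but are themselves graphs.\<close>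
definition subgraph :: "'a graph \<Rightarrow> 'a graph \<Rightarrow> bool" where
  "subgraph H G \<longleftrightarrow> finite_simple_graph H \<and> verts H \<subseteq> verts G \<and> edges H \<subseteq> edges G"

definition graph_iso :: "'a graph \<Rightarrow> 'b graph \<Rightarrow> bool" where
  "graph_iso G H \<longleftrightarrow> (\<exists>f. bij_betw f (verts G) (verts H) \<and>
     (\<forall>u\<in>verts G. \<forall>v\<in>verts G. {u, v} \<in> edges G \<longleftrightarrow> {f u, f v} \<in> edges H))"

definition num_copies :: "'a graph \<Rightarrow> 'b graph \<Rightarrow> nat" where
  "num_copies G H = card {S. subgraph S G \<and> graph_iso S H}"

definition density :: "'a graph \<Rightarrow> real" where
  "density H = real (card (edges H)) / real (card (verts H))"

definition max_density :: "'a graph \<Rightarrow> real" where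
  "max_density H = Max {density H' | H'. subgraph H' H \<and> card (verts H') > 0}"

definition random_graph :: "nat \<Rightarrow> real \<Rightarrow> nat graph pmf" where
  "random_graph n p =
     map_pmf (\<lambda>x. ({..<n}, {e \<in> [{..<n}]\<^bsup>2\<^esup>. x e}))
       (Pi_pmf ([{..<n}]\<^bsup>2\<^esup>) False (\<lambda>_. bernoulli_pmf p))"

end

theory Submission
  imports Defs
begin

text \<open>
The graphs in \<open>J\<close> have maximal density above \<open>inverse \<alpha>\<close> (equality is impossible, since densities
are rational), so the expected number of copies of a densest subgraph tends to \<open>0\<close>, and with
probability tending to \<open>1\<close> there is none (\<open>no_dense_copies\<close>). What remains is that the counts of the graphs in \<open>I\<close> are
jointly equidistributed modulo \<open>q\<close>. By Fourier inversion on \<open>(\<int>/q)\<^sup>I\<close> this means that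
\<open>f = (\<Sum>i\<in>I. b i * N(G i))\<close> satisfies \<open>E \<zeta>\<^sup>f \<longlonglongrightarrow> 0\<close> for every \<open>b \<noteq> 0\<close>, where \<open>\<zeta>\<close> is a primitive
\<open>q\<close>-th root of unity (\<open>character_mean_tendsto_0\<close>).

Among the graphs with \<open>b i \<noteq> 0\<close> let \<open>H = G i0\<close> have the largest number \<open>m\<close> of edges, and let \<open>W\<close>
consist of \<open>M\<close> disjoint copies of \<open>H\<close>, for a large constant \<open>M\<close>. Every subgraph of \<open>W\<close> has density
below \<open>inverse \<alpha>\<close>. Hence, for every set \<open>T\<close> of edges of \<open>W\<close>, the number of placements of \<open>W\<close> at which
the random graph shows exactly the pattern \<open>T\<close> is concentrated, by a second moment computation. So
the expectation of a bounded function of the random graph is, up to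
\<open>o(1)\<close>, its expectation after the edges inside a randomly placed \<open>W\<close> have been overwritten by \<open>T\<close>
(\<open>planting_second_moment\<close>, \<open>plant_overlap\<close>, \<open>slots_inside_less\<close>). Since this is true for each of the
boundedly many \<open>T\<close>, it remains true when \<open>T\<close> is averaged over all of them.

Fix the graph outside the placed \<open>W\<close>, and let \<open>T\<close> be uniformly random. Then \<open>f\<close> is a polynomial of
degree at most \<open>m\<close> in the bits that say which edges of \<open>W\<close> are in \<open>T\<close>. Split these bits into \<open>m\<close> classes, the \<open>j\<close>-th one
holding the \<open>j\<close>-th edge of each copy. A monomial of \<open>f\<close> that meets every class belongs to a copy of
some \<open>G i\<close> with at most \<open>m\<close> edges, hence to one whose edges are exactly one from each class; being
connected, it lies in one of the copies of \<open>H\<close> and is that copy (\<open>transversal_copy_is_planted\<close>). So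
the fully transversal part of \<open>f\<close> is \<open>b i0\<close> times a sum of \<open>M\<close> monomials in disjoint variables.
Differencing once in each class by the Cauchy-Schwarz inequality removes all monomials that miss a class, and
the surviving average is a product of \<open>M\<close> equal factors below \<open>1\<close> (\<open>multilinear_phase_bound\<close>), which
is as small as desired when \<open>M\<close> is large.
\<close>

section \<open>Means and expectations over random subsets\<close>

definition mean :: "'i set \<Rightarrow> ('i \<Rightarrow> 'b::real_normed_vector) \<Rightarrow> 'b" where
  "mean A f = (\<Sum>x\<in>A. f x) /\<^sub>R real (card A)"

lemma mean_const [simp]: "finite A \<Longrightarrow> A \<noteq> {} \<Longrightarrow> mean A (\<lambda>_. c) = c"
  by (simp add: mean_def scaleR_conv_of_real sum_constant_scaleR)

lemma mean_cong: "(\<And>x. x \<in> A \<Longrightarrow> f x = g x) \<Longrightarrow> mean A f = mean A g"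
  by (simp add: mean_def cong: sum.cong)

lemma mean_mono:
  fixes f g :: "'i \<Rightarrow> real"
  shows "(\<And>x. x \<in> A \<Longrightarrow> f x \<le> g x) \<Longrightarrow> mean A f \<le> mean A g"
  by (auto simp: mean_def intro!: mult_left_mono sum_mono)

lemma mean_nonneg:
  fixes f :: "'i \<Rightarrow> real"
  shows "(\<And>x. x \<in> A \<Longrightarrow> 0 \<le> f x) \<Longrightarrow> 0 \<le> mean A f"
  by (auto simp: mean_def intro!: mult_nonneg_nonneg sum_nonneg)

lemma norm_mean_le: "norm (mean A f) \<le> mean A (\<lambda>x. norm (f x))"
  by (auto simp: mean_def intro!: mult_left_mono norm_sum)

lemma norm_mean_le_const:
  assumes "\<And>x. x \<in> A \<Longrightarrow> norm (f x) \<le> c" "0 \<le> c"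
  shows "norm (mean A f) \<le> c"
proof (cases "finite A \<and> A \<noteq> {}")
  case True
  then have "mean A (\<lambda>x. norm (f x)) \<le> mean A (\<lambda>_. c)"
    by (intro mean_mono assms)
  then show ?thesis
    using norm_mean_le[of A f] True by simp
next
  case False
  then show ?thesis using assms(2) by (auto simp: mean_def)
qed

lemma mean_diff: "mean A (\<lambda>x. f x - g x) = mean A f - mean A g"
  by (simp add: mean_def sum_subtractf scaleR_diff_right)

lemma mean_add: "mean A (\<lambda>x. f x + g x) = mean A f + mean A g"
  by (simp add: mean_def sum.distrib scaleR_add_right)

lemma mean_sum: "mean A (\<lambda>x. \<Sum>i\<in>D. f i x) = (\<Sum>i\<in>D. mean A (f i))"
  unfolding mean_def by (subst sum.swap) (simp add: scaleR_sum_right)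

lemma mean_scaleR_right: "mean A (\<lambda>x. c *\<^sub>R f x) = c *\<^sub>R mean A f"
  by (simp add: mean_def scaleR_sum_right[symmetric])

lemma mean_mult_right:
  fixes c :: "'b::real_normed_algebra"
  shows "mean A (\<lambda>x. c * f x) = c * mean A f"
  by (simp add: mean_def sum_distrib_left)

lemma mean_swap: "mean A (\<lambda>x. mean B (\<lambda>y. f x y)) = mean B (\<lambda>y. mean A (\<lambda>x. f x y))"
  unfolding mean_def scaleR_sum_right[symmetric]
  by (subst sum.swap) (simp add: mult.commute)

lemma square_mean_le:
  fixes f :: "'i \<Rightarrow> real"
  shows "(mean A f)\<^sup>2 \<le> mean A (\<lambda>x. (f x)\<^sup>2)"
proof (cases "finite A \<and> A \<noteq> {}")
  case True
  define \<mu> where "\<mu> = mean A f"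
  have "0 \<le> mean A (\<lambda>x. (f x - \<mu>)\<^sup>2)"
    by (intro mean_nonneg) simp
  also have "(\<lambda>x. (f x - \<mu>)\<^sup>2) = (\<lambda>x. (f x)\<^sup>2 - (2 * \<mu>) *\<^sub>R f x + \<mu>\<^sup>2)"
    by (auto simp: power2_eq_square algebra_simps)
  also have "mean A \<dots> = mean A (\<lambda>x. (f x)\<^sup>2) - (2 * \<mu>) *\<^sub>R mean A f + \<mu>\<^sup>2"
    unfolding mean_add mean_diff mean_scaleR_right using True by simp
  finally show ?thesis
    unfolding \<mu>_def[symmetric] by (simp add: power2_eq_square)
qed (auto simp: mean_def)

text \<open>Jensen's inequality for the exponents that arise from iterated squaring.\<close>
lemma mean_power_two_power_le:
  fixes f :: "'i \<Rightarrow> real"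
  assumes "\<And>x. x \<in> A \<Longrightarrow> 0 \<le> f x"
  shows "(mean A f) ^ (2 ^ m) \<le> mean A (\<lambda>x. f x ^ (2 ^ m))"
proof (induction m)
  case (Suc m)
  have "(mean A f) ^ (2 ^ Suc m) = ((mean A f) ^ (2 ^ m))\<^sup>2"
    by (simp add: power_mult[symmetric] mult.commute)
  also have "\<dots> \<le> (mean A (\<lambda>x. f x ^ (2 ^ m)))\<^sup>2"
    by (intro power_mono Suc) (auto intro!: zero_le_power mean_nonneg assms)
  also have "\<dots> \<le> mean A (\<lambda>x. (f x ^ (2 ^ m))\<^sup>2)"
    by (rule square_mean_le)
  finally show ?case by (simp add: power_mult[symmetric] mult.commute)
qed simp

text \<open>The probability that a random subset of \<open>P\<close>, containing each point independently with probability
\<open>p\<close>, equals \<open>R\<close>. Expectations over such subsets are finite sums, so that conditioning and exchanging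
expectations are manipulations of finite sums.\<close>
definition rweight :: "'x set \<Rightarrow> real \<Rightarrow> 'x set \<Rightarrow> real" where
  "rweight P p R = p ^ card R * (1 - p) ^ card (P - R)"

definition rexp :: "'x set \<Rightarrow> real \<Rightarrow> ('x set \<Rightarrow> 'b::real_normed_vector) \<Rightarrow> 'b" where
  "rexp P p g = (\<Sum>R\<in>Pow P. rweight P p R *\<^sub>R g R)"

lemma rweight_nonneg: "0 \<le> p \<Longrightarrow> p \<le> 1 \<Longrightarrow> 0 \<le> rweight P p R"
  by (simp add: rweight_def)

lemma sum_rweight: "finite P \<Longrightarrow> (\<Sum>R\<in>Pow P. rweight P p R) = 1"
  using prod_add[of P "\<lambda>_. p" "\<lambda>_. 1 - p"] by (simp add: rweight_def)

lemma rexp_const [simp]: "finite P \<Longrightarrow> rexp P p (\<lambda>_. c) = c"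
  by (simp add: rexp_def sum_rweight scaleR_sum_left[symmetric])

lemma rexp_cong: "(\<And>R. R \<subseteq> P \<Longrightarrow> f R = g R) \<Longrightarrow> rexp P p f = rexp P p g"
  by (auto simp: rexp_def intro!: sum.cong)

lemma rexp_mono:
  fixes f g :: "'x set \<Rightarrow> real"
  assumes "0 \<le> p" "p \<le> 1" "\<And>R. R \<subseteq> P \<Longrightarrow> f R \<le> g R"
  shows "rexp P p f \<le> rexp P p g"
  using assms by (auto simp: rexp_def intro!: sum_mono mult_left_mono rweight_nonneg)

lemma norm_rexp_le:
  assumes "0 \<le> p" "p \<le> 1"
  shows "norm (rexp P p f) \<le> rexp P p (\<lambda>R. norm (f R))"
  unfolding rexp_def
  by (rule order.trans[OF norm_sum]) (use assms in \<open>simp add: rweight_nonneg\<close>)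

lemma norm_rexp_le_const:
  assumes "finite P" "0 \<le> p" "p \<le> 1" "\<And>R. R \<subseteq> P \<Longrightarrow> norm (f R) \<le> c"
  shows "norm (rexp P p f) \<le> c"
proof -
  have "norm (rexp P p f) \<le> rexp P p (\<lambda>R. norm (f R))" by (rule norm_rexp_le[OF assms(2,3)])
  also have "\<dots> \<le> rexp P p (\<lambda>_. c)" by (rule rexp_mono[OF assms(2-4)])
  finally show ?thesis using assms(1) by simp
qed

lemma rexp_diff: "rexp P p (\<lambda>R. f R - g R) = rexp P p f - rexp P p g"
  by (simp add: rexp_def sum_subtractf scaleR_diff_right)

lemma rexp_add: "rexp P p (\<lambda>R. f R + g R) = rexp P p f + rexp P p g"
  by (simp add: rexp_def sum.distrib scaleR_add_right)

lemma rexp_sum: "rexp P p (\<lambda>R. \<Sum>i\<in>D. f i R) = (\<Sum>i\<in>D. rexp P p (f i))"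
  unfolding rexp_def scaleR_sum_right by (rule sum.swap)

lemma rexp_scaleR_right: "rexp P p (\<lambda>R. c *\<^sub>R f R) = c *\<^sub>R rexp P p f"
  by (simp add: rexp_def scaleR_sum_right mult.commute)

lemma rexp_mult_right:
  fixes c :: "'b::real_normed_algebra"
  shows "rexp P p (\<lambda>R. c * f R) = c * rexp P p f"
  by (simp add: rexp_def sum_distrib_left)

lemma mean_rexp: "mean A (\<lambda>x. rexp P p (f x)) = rexp P p (\<lambda>R. mean A (\<lambda>x. f x R))"
  by (simp add: mean_def rexp_sum rexp_scaleR_right)

lemma square_rexp_le:
  fixes f :: "'x set \<Rightarrow> real"
  assumes "finite P" "0 \<le> p" "p \<le> 1"
  shows "(rexp P p f)\<^sup>2 \<le> rexp P p (\<lambda>R. (f R)\<^sup>2)"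
proof -
  define \<mu> where "\<mu> = rexp P p f"
  have "0 \<le> rexp P p (\<lambda>R. (f R - \<mu>)\<^sup>2)"
    using rexp_mono[of p P "\<lambda>_. 0" "\<lambda>R. (f R - \<mu>)\<^sup>2"] assms by simp
  also have "(\<lambda>R. (f R - \<mu>)\<^sup>2) = (\<lambda>R. (f R)\<^sup>2 - (2 * \<mu>) *\<^sub>R f R + \<mu>\<^sup>2)"
    by (auto simp: power2_eq_square algebra_simps)
  also have "rexp P p \<dots> = rexp P p (\<lambda>R. (f R)\<^sup>2) - (2 * \<mu>) *\<^sub>R rexp P p f + \<mu>\<^sup>2"
    unfolding rexp_add rexp_diff rexp_scaleR_right using assms by simp
  finally show ?thesis
    unfolding \<mu>_def[symmetric] by (simp add: power2_eq_square)
qed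

text \<open>Independence of the parts of the random subset inside and outside \<open>Q\<close>.\<close>
lemma rexp_split:
  assumes "finite P" "Q \<subseteq> P"
  shows "rexp P p g = (\<Sum>T\<in>Pow Q. rweight Q p T *\<^sub>R rexp (P - Q) p (\<lambda>R. g (R \<union> T)))"
proof -
  have w: "rweight P p (R \<union> T) = rweight Q p T * rweight (P - Q) p R"
    if "T \<subseteq> Q" "R \<subseteq> P - Q" for R T
  proof -
    have "finite T" "finite R" "finite Q"
      using that assms by (meson finite_subset finite_Diff)+
    then have 1: "card (R \<union> T) = card R + card T"
      using that by (intro card_Un_disjoint) auto
    have "P - (R \<union> T) = (Q - T) \<union> (P - Q - R)"
      using that assms by auto
    moreover have "card ((Q - T) \<union> (P - Q - R)) = card (Q - T) + card (P - Q - R)"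
      using that assms \<open>finite Q\<close> by (intro card_Un_disjoint) auto
    ultimately show ?thesis
      using 1 by (simp add: rweight_def power_add algebra_simps)
  qed
  have "(\<Sum>T\<in>Pow Q. rweight Q p T *\<^sub>R rexp (P - Q) p (\<lambda>R. g (R \<union> T)))
      = (\<Sum>T\<in>Pow Q. \<Sum>R\<in>Pow (P - Q). rweight P p (R \<union> T) *\<^sub>R g (R \<union> T))"
    by (auto simp: rexp_def scaleR_sum_right w intro!: sum.cong)
  also have "\<dots> = (\<Sum>(T, R)\<in>Pow Q \<times> Pow (P - Q). rweight P p (R \<union> T) *\<^sub>R g (R \<union> T))"
    by (simp add: sum.cartesian_product)
  also have "\<dots> = (\<Sum>R\<in>Pow P. rweight P p R *\<^sub>R g R)"
    by (rule sum.reindex_bij_witness[where i = "\<lambda>R. (R \<inter> Q, R - Q)" and j = "\<lambda>(T, R). R \<union> T"])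
       (use assms in auto)
  finally show ?thesis by (simp add: rexp_def)
qed

text \<open>Conditioning on the trace on \<open>Q\<close> amounts to overwriting that trace by \<open>T\<close>.\<close>
lemma rexp_event:
  assumes "finite P" "Q \<subseteq> P" "T \<subseteq> Q"
  shows "rexp P p (\<lambda>R. of_bool (R \<inter> Q = T) *\<^sub>R g R)
       = rweight Q p T *\<^sub>R rexp (P - Q) p (\<lambda>R. g (R \<union> T))"
proof -
  have fQ: "finite Q" using assms finite_subset by blast
  have "rexp P p (\<lambda>R. of_bool (R \<inter> Q = T) *\<^sub>R g R)
      = (\<Sum>T'\<in>Pow Q. rweight Q p T' *\<^sub>R
           rexp (P - Q) p (\<lambda>R. of_bool ((R \<union> T') \<inter> Q = T) *\<^sub>R g (R \<union> T')))"
    by (rule rexp_split[OF assms(1,2)])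
  also have "\<dots> = (\<Sum>T'\<in>Pow Q. if T' = T then rweight Q p T *\<^sub>R rexp (P - Q) p (\<lambda>R. g (R \<union> T)) else 0)"
  proof (rule sum.cong, goal_cases)
    case (2 T')
    have *: "(R \<union> T') \<inter> Q = T'" if "R \<subseteq> P - Q" for R using that 2 by auto
    have "rexp (P - Q) p (\<lambda>R. of_bool ((R \<union> T') \<inter> Q = T) *\<^sub>R g (R \<union> T'))
        = rexp (P - Q) p (\<lambda>R. if T' = T then g (R \<union> T) else 0)"
      by (rule rexp_cong) (auto simp: *)
    then show ?case using assms(1) by auto
  qed simp
  also have "\<dots> = rweight Q p T *\<^sub>R rexp (P - Q) p (\<lambda>R. g (R \<union> T))"
    using assms fQ by (simp add: sum.delta)
  finally show ?thesis .
qed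

lemma rexp_superset:
  assumes "finite P" "B \<subseteq> P"
  shows "rexp P p (\<lambda>R. of_bool (B \<subseteq> R)) = p ^ card B"
proof -
  have "(\<lambda>R. of_bool (B \<subseteq> R) :: real) = (\<lambda>R. of_bool (R \<inter> B = B) *\<^sub>R 1)"
    by (auto simp: fun_eq_iff)
  then show ?thesis
    using rexp_event[OF assms order.refl, of p "\<lambda>_. 1 :: real"] assms
    by (simp add: rweight_def)
qed

lemma prob_random_graph:
  assumes "0 \<le> p" "p \<le> 1"
  shows "measure_pmf.prob (random_graph n p) {\<Gamma>. Q \<Gamma>}
       = rexp ([{..<n}]\<^bsup>2\<^esup>) p (\<lambda>R. of_bool (Q ({..<n}, R)))"
proof -
  define P where "P = [{..<n}]\<^bsup>2\<^esup>"
  have fin: "finite P" by (simp add: P_def finite_imp_finite_nsets)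
  define M where "M = Pi_pmf P False (\<lambda>_. bernoulli_pmf p)"
  have "measure_pmf.prob (random_graph n p) {\<Gamma>. Q \<Gamma>}
      = measure_pmf.prob M {x. Q ({..<n}, {e \<in> P. x e})}"
    by (simp add: random_graph_def P_def M_def vimage_def)
  also have "\<dots> = measure_pmf.prob M ((\<lambda>R x. x \<in> R) ` {R \<in> Pow P. Q ({..<n}, R)})"
  proof (rule measure_pmf.finite_measure_eq_AE)
    show "AE x in measure_pmf M. (x \<in> {x. Q ({..<n}, {e \<in> P. x e})}) =
            (x \<in> (\<lambda>R x. x \<in> R) ` {R \<in> Pow P. Q ({..<n}, R)})"
    proof (rule AE_pmfI)
      fix x assume "x \<in> set_pmf M"
      then have x: "\<forall>e. e \<notin> P \<longrightarrow> \<not> x e"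
        using set_Pi_pmf_subset[OF fin] unfolding M_def by fastforce
      then have eq: "x = (\<lambda>e. e \<in> {e \<in> P. x e})" by auto
      show "(x \<in> {x. Q ({..<n}, {e \<in> P. x e})}) =
            (x \<in> (\<lambda>R x. x \<in> R) ` {R \<in> Pow P. Q ({..<n}, R)})"
      proof
        assume "x \<in> {x. Q ({..<n}, {e \<in> P. x e})}"
        then have "{e \<in> P. x e} \<in> {R \<in> Pow P. Q ({..<n}, R)}" by auto
        with eq show "x \<in> (\<lambda>R x. x \<in> R) ` {R \<in> Pow P. Q ({..<n}, R)}"
          by (rule image_eqI)
      next
        assume "x \<in> (\<lambda>R x. x \<in> R) ` {R \<in> Pow P. Q ({..<n}, R)}"
        then obtain R where R: "R \<subseteq> P" "Q ({..<n}, R)" "x = (\<lambda>e. e \<in> R)" by blast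
        moreover have "{e \<in> P. e \<in> R} = R" using R(1) by blast
        ultimately show "x \<in> {x. Q ({..<n}, {e \<in> P. x e})}" by simp
      qed
    qed
  qed auto
  also have "\<dots> = (\<Sum>x\<in>(\<lambda>R x. x \<in> R) ` {R \<in> Pow P. Q ({..<n}, R)}. pmf M x)"
    using fin by (intro measure_measure_pmf_finite) auto
  also have "\<dots> = (\<Sum>R\<in>{R \<in> Pow P. Q ({..<n}, R)}. pmf M (\<lambda>e. e \<in> R))"
    by (subst sum.reindex) (auto simp: inj_on_def fun_eq_iff)
  also have "\<dots> = (\<Sum>R\<in>{R \<in> Pow P. Q ({..<n}, R)}. rweight P p R)"
  proof (rule sum.cong, goal_cases)
    case (2 R)
    then have R: "R \<subseteq> P" by auto
    have "pmf M (\<lambda>e. e \<in> R) = (\<Prod>e\<in>P. if e \<in> R then p else 1 - p)"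
      unfolding M_def using R fin assms by (subst pmf_Pi') (auto intro!: prod.cong)
    also have "\<dots> = (\<Prod>e\<in>R. if e \<in> R then p else 1 - p) * (\<Prod>e\<in>P - R. if e \<in> R then p else 1 - p)"
      using prod.subset_diff[OF R fin, of "\<lambda>e. if e \<in> R then p else 1 - p"] by (simp add: mult.commute)
    also have "\<dots> = rweight P p R"
      by (simp add: rweight_def)
    finally show ?case .
  qed simp
  also have "\<dots> = rexp P p (\<lambda>R. of_bool (Q ({..<n}, R)))"
    unfolding rexp_def by (rule sum.mono_neutral_cong_left) (use fin in auto)
  finally show ?thesis by (simp add: P_def)
qed

section \<open>Planting a pattern by the second moment method\<close>

text \<open>Let \<open>Z\<close> be the normalized number of placements at which the random set shows exactly the
pattern \<open>T\<close>, so that \<open>E Z = 1\<close>. Conditioning on the pattern at each placement shows that \<open>E (Z \<Phi>)\<close>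
is the expectation of \<open>\<Phi>\<close> after planting \<open>T\<close> at a random placement. It differs from \<open>E \<Phi>\<close> by at most
\<open>E \<bar>Z - 1\<bar> \<le> sqrt (E Z\<^sup>2 - 1)\<close>, and \<open>E Z\<^sup>2\<close> is governed by how much two random placements overlap.\<close>
lemma planting_second_moment:
  fixes \<Phi> :: "'x set \<Rightarrow> 'b::real_normed_vector" and \<phi> :: "'p \<Rightarrow> 's \<Rightarrow> 'x"
  assumes "finite P" "finite L" "L \<noteq> {}" "finite F" "T \<subseteq> F"
    and inj: "\<And>\<pi>. \<pi> \<in> L \<Longrightarrow> inj_on (\<phi> \<pi>) F"
    and sub: "\<And>\<pi>. \<pi> \<in> L \<Longrightarrow> \<phi> \<pi> ` F \<subseteq> P"
    and p: "0 < p" "p < 1"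
    and \<Phi>: "\<And>R. norm (\<Phi> R) \<le> 1"
  shows "norm (rexp P p \<Phi> - mean L (\<lambda>\<pi>. rexp (P - \<phi> \<pi> ` F) p (\<lambda>R. \<Phi> (R \<union> \<phi> \<pi> ` T))))
    \<le> sqrt (inverse (1 - p) ^ (2 * card (F - T)) *
          mean L (\<lambda>\<pi>. mean L (\<lambda>\<pi>'. inverse p ^ card (\<phi> \<pi> ` T \<inter> \<phi> \<pi>' ` T))) - 1)"
proof -
  define w where "w = p ^ card T * (1 - p) ^ card (F - T)"
  have w: "w > 0" using p by (simp add: w_def)
  have finT: "finite T" using assms finite_subset by blast
  have cardT: "card (\<phi> \<pi> ` T) = card T" if "\<pi> \<in> L" for \<pi>
    using inj[OF that] assms(5) by (meson card_image inj_on_subset)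
  have rw: "rweight (\<phi> \<pi> ` F) p (\<phi> \<pi> ` T) = w" if "\<pi> \<in> L" for \<pi>
  proof -
    have "\<phi> \<pi> ` F - \<phi> \<pi> ` T = \<phi> \<pi> ` (F - T)"
      using inj[OF that] assms(5) by (simp add: inj_on_image_set_diff)
    moreover have "card (\<phi> \<pi> ` (F - T)) = card (F - T)"
      using inj[OF that] by (meson Diff_subset card_image inj_on_subset)
    ultimately show ?thesis
      using cardT[OF that] by (simp add: rweight_def w_def)
  qed
  define hit where "hit = (\<lambda>\<pi> R. of_bool (R \<inter> \<phi> \<pi> ` F = \<phi> \<pi> ` T) :: real)"
  define Z where "Z = (\<lambda>R. mean L (\<lambda>\<pi>. hit \<pi> R / w))"
  have hit: "rexp P p (\<lambda>R. hit \<pi> R *\<^sub>R g R) = w *\<^sub>R rexp (P - \<phi> \<pi> ` F) p (\<lambda>R. g (R \<union> \<phi> \<pi> ` T))"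
    if "\<pi> \<in> L" for \<pi> and g :: "'x set \<Rightarrow> 'c::real_normed_vector"
    unfolding hit_def
    by (subst rexp_event) (use assms(1,5) sub[OF that] rw[OF that] in auto)
  have main: "rexp P p (\<lambda>R. Z R *\<^sub>R g R) = mean L (\<lambda>\<pi>. rexp (P - \<phi> \<pi> ` F) p (\<lambda>R. g (R \<union> \<phi> \<pi> ` T)))"
    for g :: "'x set \<Rightarrow> 'c::real_normed_vector"
  proof -
    have "(\<lambda>R. Z R *\<^sub>R g R) = (\<lambda>R. mean L (\<lambda>\<pi>. (1 / w) *\<^sub>R (hit \<pi> R *\<^sub>R g R)))"
      by (simp add: Z_def mean_def fun_eq_iff scaleR_sum_left scaleR_sum_right sum_distrib_right
          sum_distrib_left sum_divide_distrib divide_inverse mult_ac)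
    then have "rexp P p (\<lambda>R. Z R *\<^sub>R g R)
        = mean L (\<lambda>\<pi>. rexp P p (\<lambda>R. (1 / w) *\<^sub>R (hit \<pi> R *\<^sub>R g R)))"
      by (simp only: mean_rexp)
    also have "\<dots> = mean L (\<lambda>\<pi>. rexp (P - \<phi> \<pi> ` F) p (\<lambda>R. g (R \<union> \<phi> \<pi> ` T)))"
      by (rule mean_cong) (use w in \<open>simp only: rexp_scaleR_right hit, simp\<close>)
    finally show ?thesis .
  qed
  have EZ: "rexp P p Z = 1"
    using main[of "\<lambda>_. 1 :: real"] assms(1-3) by simp
  have "rexp P p (\<lambda>R. (Z R)\<^sup>2)
      = mean L (\<lambda>\<pi>. mean L (\<lambda>\<pi>'. rexp P p (\<lambda>R. hit \<pi> R / w * (hit \<pi>' R / w))))"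
  proof -
    have "(Z R)\<^sup>2 = mean L (\<lambda>\<pi>. mean L (\<lambda>\<pi>'. hit \<pi> R / w * (hit \<pi>' R / w)))" for R
      unfolding Z_def mean_def power2_eq_square real_scaleR_def sum_distrib_left[symmetric]
        sum_distrib_right[symmetric]
      by (simp add: algebra_simps sum_distrib_left[symmetric] sum_distrib_right[symmetric])
    then show ?thesis by (simp only: mean_rexp)
  qed
  also have "\<dots> \<le> mean L (\<lambda>\<pi>. mean L (\<lambda>\<pi>'. inverse (1 - p) ^ (2 * card (F - T)) *
                    inverse p ^ card (\<phi> \<pi> ` T \<inter> \<phi> \<pi>' ` T)))"
  proof (intro mean_mono)
    fix \<pi> \<pi>' assume \<pi>: "\<pi> \<in> L" "\<pi>' \<in> L"
    define B where "B = \<phi> \<pi> ` T \<union> \<phi> \<pi>' ` T"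
    have B: "B \<subseteq> P" using sub[OF \<pi>(1)] sub[OF \<pi>(2)] assms(5) unfolding B_def by blast
    \<comment> \<open>Only the present edges of both patterns are kept. The absent ones cost a power of \<open>1 - p\<close>, which is harmless because \<open>p\<close> tends to \<open>0\<close>.\<close>
    have "rexp P p (\<lambda>R. hit \<pi> R / w * (hit \<pi>' R / w)) \<le> rexp P p (\<lambda>R. (1 / w\<^sup>2) * of_bool (B \<subseteq> R))"
      by (intro rexp_mono) (use p w in \<open>auto simp: hit_def B_def power2_eq_square\<close>)
    also have "\<dots> = p ^ card B / w\<^sup>2"
      unfolding rexp_mult_right using rexp_superset[OF assms(1) B, of p] by simp
    also have "\<dots> = inverse (1 - p) ^ (2 * card (F - T)) * inverse p ^ card (\<phi> \<pi> ` T \<inter> \<phi> \<pi>' ` T)"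
    proof -
      have "card B + card (\<phi> \<pi> ` T \<inter> \<phi> \<pi>' ` T) = 2 * card T"
        using card_Un_Int[of "\<phi> \<pi> ` T" "\<phi> \<pi>' ` T"] finT cardT \<pi> by (simp add: B_def)
      then have "p ^ card B * p ^ card (\<phi> \<pi> ` T \<inter> \<phi> \<pi>' ` T) = (p ^ card T)\<^sup>2"
        by (metis power_add power_mult mult.commute)
      moreover have "w\<^sup>2 = (p ^ card T)\<^sup>2 * (1 - p) ^ (2 * card (F - T))"
        by (simp add: w_def power_mult_distrib power_mult[symmetric] mult.commute)
      ultimately have "w\<^sup>2 = p ^ card B * p ^ card (\<phi> \<pi> ` T \<inter> \<phi> \<pi>' ` T) * (1 - p) ^ (2 * card (F - T))"
        by simp
      then show ?thesis using p
        by (simp add: field_simps)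
    qed
    finally show "rexp P p (\<lambda>R. hit \<pi> R / w * (hit \<pi>' R / w))
        \<le> inverse (1 - p) ^ (2 * card (F - T)) * inverse p ^ card (\<phi> \<pi> ` T \<inter> \<phi> \<pi>' ` T)" .
  qed
  also have "\<dots> = inverse (1 - p) ^ (2 * card (F - T)) *
          mean L (\<lambda>\<pi>. mean L (\<lambda>\<pi>'. inverse p ^ card (\<phi> \<pi> ` T \<inter> \<phi> \<pi>' ` T)))"
    by (simp only: mean_mult_right)
  finally have EZ2: "rexp P p (\<lambda>R. (Z R)\<^sup>2) \<le> inverse (1 - p) ^ (2 * card (F - T)) *
          mean L (\<lambda>\<pi>. mean L (\<lambda>\<pi>'. inverse p ^ card (\<phi> \<pi> ` T \<inter> \<phi> \<pi>' ` T)))" .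
  have "rexp P p \<Phi> - mean L (\<lambda>\<pi>. rexp (P - \<phi> \<pi> ` F) p (\<lambda>R. \<Phi> (R \<union> \<phi> \<pi> ` T)))
      = rexp P p (\<lambda>R. (1 - Z R) *\<^sub>R \<Phi> R)"
    by (simp add: main[symmetric] rexp_diff[symmetric] scaleR_diff_left)
  also have "norm \<dots> \<le> rexp P p (\<lambda>R. \<bar>1 - Z R\<bar> * norm (\<Phi> R))"
    using norm_rexp_le[of p P "\<lambda>R. (1 - Z R) *\<^sub>R \<Phi> R"] p by simp
  also have "\<dots> \<le> rexp P p (\<lambda>R. \<bar>1 - Z R\<bar>)"
    by (intro rexp_mono) (use p \<Phi> in \<open>auto intro: mult_left_le\<close>)
  also have "\<dots> \<le> sqrt (rexp P p (\<lambda>R. \<bar>1 - Z R\<bar>\<^sup>2))"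
    by (intro real_le_rsqrt square_rexp_le) (use assms(1) p in auto)
  also have "rexp P p (\<lambda>R. \<bar>1 - Z R\<bar>\<^sup>2) = rexp P p (\<lambda>R. (Z R)\<^sup>2 - 2 *\<^sub>R Z R + 1)"
    by (rule rexp_cong) (simp add: power2_eq_square algebra_simps)
  also have "\<dots> = rexp P p (\<lambda>R. (Z R)\<^sup>2) - 1"
    unfolding rexp_add rexp_diff rexp_scaleR_right using EZ assms(1) by simp
  finally show ?thesis
    using EZ2 by (meson diff_right_mono order_trans real_sqrt_le_mono)
qed

section \<open>Characters and multilinear phases\<close>

text \<open>The standard additive character of the integers modulo \<open>q\<close>.\<close>
definition zeta :: "nat \<Rightarrow> int \<Rightarrow> complex" where
  "zeta q c = cis (2 * pi * of_int c / real q)"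

lemma zeta_0 [simp]: "zeta q 0 = 1"
  by (simp add: zeta_def)

lemma zeta_add: "zeta q (b + c) = zeta q b * zeta q c"
  by (simp add: zeta_def cis_mult ring_distribs add_divide_distrib)

lemma norm_zeta [simp]: "norm (zeta q c) = 1"
  by (simp add: zeta_def)

lemma cnj_zeta: "cnj (zeta q c) = zeta q (- c)"
  by (simp add: zeta_def cis_cnj)

lemma zeta_diff: "zeta q (b - c) = zeta q b * cnj (zeta q c)"
  using zeta_add[of q b "- c"] by (simp add: cnj_zeta)

lemma zeta_sum: "zeta q (\<Sum>k\<in>K. c k) = (\<Prod>k\<in>K. zeta q (c k))"
  by (induction K rule: infinite_finite_induct) (auto simp: zeta_add)

lemma zeta_power: "zeta q (int b * c) = zeta q c ^ b"
  unfolding zeta_def Complex.DeMoivre by (rule arg_cong[of _ _ cis]) simp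

lemma Re_zeta_eq_1_iff:
  assumes "q > 0"
  shows "Re (zeta q c) = 1 \<longleftrightarrow> int q dvd c"
proof -
  have "Re (zeta q c) = 1 \<longleftrightarrow> (\<exists>k::int. 2 * pi * of_int c / real q = of_int k * 2 * pi)"
    by (simp add: zeta_def cos_one_2pi_int)
  also have "\<dots> \<longleftrightarrow> (\<exists>k::int. (of_int c :: real) = of_int (k * int q))"
    using assms by (simp add: field_simps)
  also have "\<dots> \<longleftrightarrow> int q dvd c"
    by (simp only: of_int_eq_iff) (auto simp: dvd_def mult.commute)
  finally show ?thesis .
qed

lemma zeta_eq_1_iff: "q > 0 \<Longrightarrow> zeta q c = 1 \<longleftrightarrow> int q dvd c"
proof
  assume q: "q > 0"
  show "int q dvd c" if "zeta q c = 1"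
    using that Re_zeta_eq_1_iff[OF q, of c] by simp
  assume "int q dvd c"
  then have 1: "Re (zeta q c) = 1" using q by (simp add: Re_zeta_eq_1_iff)
  have "(Re (zeta q c))\<^sup>2 + (Im (zeta q c))\<^sup>2 = 1"
    using cmod_power2[of "zeta q c"] by simp
  with 1 have "Im (zeta q c) = 0" by simp
  with 1 show "zeta q c = 1" by (simp add: complex_eq_iff)
qed

lemma sum_zeta_roots:
  assumes "q > 0"
  shows "(\<Sum>b<q. zeta q (int b * c)) = (if int q dvd c then of_nat q else 0)"
proof (cases "int q dvd c")
  case True
  then have "zeta q c = 1" using assms zeta_eq_1_iff by blast
  then show ?thesis using True by (simp add: zeta_power)
next
  case False
  then have "zeta q c \<noteq> 1" using assms zeta_eq_1_iff by blast
  moreover have "zeta q c ^ q = 1"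
    using assms by (simp add: zeta_power[symmetric] zeta_eq_1_iff)
  ultimately show ?thesis using False by (simp add: zeta_power geometric_sum)
qed

text \<open>A sum over all subsets is a sum over independent bits, hence factorizes.\<close>
lemma sum_Pow_prod:
  fixes g :: "'a \<Rightarrow> bool \<Rightarrow> 'b::comm_semiring_1"
  assumes "finite A"
  shows "(\<Sum>x\<in>Pow A. \<Prod>a\<in>A. g a (a \<in> x)) = (\<Prod>a\<in>A. g a True + g a False)"
proof -
  have "(\<Prod>a\<in>A. g a True + g a False) = (\<Sum>x\<in>Pow A. (\<Prod>a\<in>x. g a True) * (\<Prod>a\<in>A - x. g a False))"
    by (rule prod_add[OF assms])
  also have "\<dots> = (\<Sum>x\<in>Pow A. \<Prod>a\<in>A. g a (a \<in> x))"
  proof (rule sum.cong, goal_cases)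
    case (2 x)
    then have "x \<subseteq> A" by auto
    then show ?case
      using prod.subset_diff[OF _ assms, of x "\<lambda>a. g a (a \<in> x)"] by (simp add: mult.commute)
  qed simp
  finally show ?thesis ..
qed

lemma mean_Pow_prod:
  fixes g :: "'a \<Rightarrow> bool \<Rightarrow> 'b::{real_normed_field}"
  assumes "finite A"
  shows "mean (Pow A) (\<lambda>x. \<Prod>a\<in>A. g a (a \<in> x)) = (\<Prod>a\<in>A. (g a True + g a False) / 2)"
  using assms
  by (simp add: mean_def sum_Pow_prod card_Pow prod_dividef scaleR_conv_of_real field_simps)

lemma mean_lists_Suc:
  assumes "finite X"
  shows "mean {xs. set xs \<subseteq> X \<and> length xs = Suc m} g
       = mean X (\<lambda>x. mean {xs. set xs \<subseteq> X \<and> length xs = m} (\<lambda>xs. g (x # xs)))"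
proof -
  let ?L = "{xs. set xs \<subseteq> X \<and> length xs = m}"
  have "(\<Sum>xs | set xs \<subseteq> X \<and> length xs = Suc m. g xs) = (\<Sum>(xs, x)\<in>?L \<times> X. g (x # xs))"
    unfolding lists_length_Suc_eq
    by (subst sum.reindex) (auto simp: inj_on_def intro!: sum.cong)
  also have "\<dots> = (\<Sum>x\<in>X. \<Sum>xs\<in>?L. g (x # xs))"
    by (subst sum.swap) (simp add: sum.cartesian_product)
  finally show ?thesis
    using assms by (simp add: mean_def card_lists_length_eq scaleR_sum_right)
qed

text \<open>One pair of bits differenced in each of \<open>m\<close> classes contributes this factor. For \<open>m = 1\<close> it is
\<open>(norm ((1 + zeta q c) / 2))\<^sup>2\<close>, and one more class replaces the value at \<open>c\<close> by the average of the values
at \<open>c * (u - v)\<close> over bits \<open>u\<close> and \<open>v\<close>; the closed form solves this recursion.\<close>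
definition decay :: "nat \<Rightarrow> nat \<Rightarrow> int \<Rightarrow> real" where
  "decay q m c = 1 - (1 - Re (zeta q c)) / 2 ^ m"

lemma decay_0 [simp]: "decay q m 0 = 1"
  by (simp add: decay_def)

lemma decay_minus [simp]: "decay q m (- c) = decay q m c"
  by (simp add: decay_def cnj_zeta[symmetric])

lemma decay_Suc: "decay q (Suc m) c = (1 + decay q m c) / 2"
  by (simp add: decay_def field_simps)

lemma Re_zeta_le_1: "Re (zeta q c) \<le> 1"
  using abs_Re_le_cmod[of "zeta q c"] by simp

lemma decay_nonneg: "m > 0 \<Longrightarrow> 0 \<le> decay q m c"
proof -
  assume "m > 0"
  then have "(2::real) ^ m \<ge> 2 ^ 1" by (intro power_increasing) auto
  moreover have "1 - Re (zeta q c) \<le> 2"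
    using abs_Re_le_cmod[of "zeta q c"] by simp
  ultimately show ?thesis by (simp add: decay_def field_simps)
qed

lemma decay_less_1: "q > 0 \<Longrightarrow> \<not> int q dvd c \<Longrightarrow> decay q m c < 1"
  using Re_zeta_le_1[of q c] Re_zeta_eq_1_iff[of q c] by (simp add: decay_def)

lemma norm_half_1_plus_zeta: "(norm ((zeta q c + 1) / 2))\<^sup>2 = decay q 1 c"
proof -
  have "(Re (zeta q c))\<^sup>2 + (Im (zeta q c))\<^sup>2 = 1"
    using cmod_power2[of "zeta q c"] by simp
  then show ?thesis
    unfolding cmod_power2 decay_def by (simp add: power_divide power2_eq_square field_simps)
qed

lemma norm_mean_zeta_sq:
  "(norm (mean X (\<lambda>x. zeta q (f x))))\<^sup>2
     = Re (mean X (\<lambda>x. mean X (\<lambda>y. zeta q (f x - f y))))"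
proof -
  have "complex_of_real ((norm (mean X (\<lambda>x. zeta q (f x))))\<^sup>2)
      = mean X (\<lambda>x. zeta q (f x)) * cnj (mean X (\<lambda>x. zeta q (f x)))"
    by (rule complex_norm_square)
  also have "\<dots> = mean X (\<lambda>x. mean X (\<lambda>y. zeta q (f x - f y)))"
    unfolding mean_def zeta_diff
    by (simp add: sum_product sum_distrib_left scaleR_sum_right scaleR_conv_of_real mult_ac) (rule sum.swap)
  finally show ?thesis by (metis Re_complex_of_real)
qed

text \<open>The Cauchy-Schwarz step: squaring trades the first variable for two copies of it, and any part of
the phase that does not depend on that variable cancels in the difference.\<close>
lemma van_der_corput:
  shows "(norm (mean X (\<lambda>x. mean Y (\<lambda>t. zeta q (f x t)))))\<^sup>2
     \<le> mean X (\<lambda>x. mean X (\<lambda>y. norm (mean Y (\<lambda>t. zeta q (f x t - f y t)))))"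
proof -
  have "(norm (mean X (\<lambda>x. mean Y (\<lambda>t. zeta q (f x t)))))\<^sup>2
      = (norm (mean Y (\<lambda>t. mean X (\<lambda>x. zeta q (f x t)))))\<^sup>2"
    by (subst mean_swap) simp
  also have "\<dots> \<le> (mean Y (\<lambda>t. norm (mean X (\<lambda>x. zeta q (f x t)))))\<^sup>2"
    by (intro power_mono norm_mean_le) simp
  also have "\<dots> \<le> mean Y (\<lambda>t. (norm (mean X (\<lambda>x. zeta q (f x t))))\<^sup>2)"
    by (rule square_mean_le)
  also have "\<dots> = mean Y (\<lambda>t. Re (mean X (\<lambda>x. mean X (\<lambda>y. zeta q (f x t - f y t)))))"
    by (simp add: norm_mean_zeta_sq)
  also have "\<dots> = Re (mean Y (\<lambda>t. mean X (\<lambda>x. mean X (\<lambda>y. zeta q (f x t - f y t)))))"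
    by (simp add: mean_def)
  also have "mean Y (\<lambda>t. mean X (\<lambda>x. mean X (\<lambda>y. zeta q (f x t - f y t))))
      = mean X (\<lambda>x. mean X (\<lambda>y. mean Y (\<lambda>t. zeta q (f x t - f y t))))"
    by (subst mean_swap) (subst mean_swap[of Y], simp)
  also have "Re \<dots> \<le> norm \<dots>" by (rule complex_Re_le_cmod)
  also have "\<dots> \<le> mean X (\<lambda>x. norm (mean X (\<lambda>y. mean Y (\<lambda>t. zeta q (f x t - f y t)))))"
    by (rule norm_mean_le)
  also have "\<dots> \<le> mean X (\<lambda>x. mean X (\<lambda>y. norm (mean Y (\<lambda>t. zeta q (f x t - f y t)))))"
    by (intro mean_mono norm_mean_le)
  finally show ?thesis .
qed

text \<open>The phase is a sum of products with one factor per class, and each class ranges over all subsets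
of \<open>A\<close>. Differencing in the first class keeps the shape and multiplies the coefficient of the \<open>k\<close>-th
product by \<open>h k 0 x - h k 0 y\<close>. Hence a product with some constant factor disappears
when its class is reached, while the products indexed by \<open>A\<close> involve different bits and factorize.
The induction starts at one class, where the absolute value removes the constant part of
the phase; with no class left, the left-hand side would be \<open>1\<close>.\<close>
lemma multilinear_phase_bound:
  fixes c :: "'k \<Rightarrow> int" and h :: "'k \<Rightarrow> nat \<Rightarrow> 'a set \<Rightarrow> int"
  assumes "finite A" "finite K" "inj_on \<kappa> A" "\<kappa> ` A \<subseteq> K"
    and "\<And>a j x. a \<in> A \<Longrightarrow> j < Suc m \<Longrightarrow> x \<subseteq> A \<Longrightarrow> h (\<kappa> a) j x = of_bool (a \<in> x)"
    and "\<And>k. k \<in> K - \<kappa> ` A \<Longrightarrow> c k = 0 \<or> (\<exists>j<Suc m. \<forall>x\<in>Pow A. \<forall>y\<in>Pow A. h k j x = h k j y)"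
  shows "norm (mean {xs. set xs \<subseteq> Pow A \<and> length xs = Suc m}
           (\<lambda>xs. zeta q (\<Sum>k\<in>K. c k * (\<Prod>j<Suc m. h k j (xs ! j))))) ^ (2 ^ Suc m)
       \<le> (\<Prod>a\<in>A. decay q (Suc m) (c (\<kappa> a)))"
  using assms(5,6)
proof (induction m arbitrary: c h)
  case 0
  define c0 where "c0 = (\<Sum>k\<in>K - \<kappa> ` A. c k * h k 0 {})"
  have split: "(\<Sum>k\<in>K. c k * h k 0 x) = c0 + (\<Sum>a\<in>A. c (\<kappa> a) * of_bool (a \<in> x))"
    if x: "x \<in> Pow A" for x
  proof -
    have "(\<Sum>k\<in>K. c k * h k 0 x) = (\<Sum>k\<in>K - \<kappa> ` A. c k * h k 0 x) + (\<Sum>k\<in>\<kappa> ` A. c k * h k 0 x)"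
      by (rule sum.subset_diff) (use assms in auto)
    also have "(\<Sum>k\<in>K - \<kappa> ` A. c k * h k 0 x) = c0"
      unfolding c0_def
    proof (rule sum.cong, goal_cases)
      case (2 k)
      then have "c k = 0 \<or> h k 0 x = h k 0 {}" using 0(2)[of k] x by auto
      then show ?case by auto
    qed simp
    also have "(\<Sum>k\<in>\<kappa> ` A. c k * h k 0 x) = (\<Sum>a\<in>A. c (\<kappa> a) * of_bool (a \<in> x))"
      using assms(3) 0(1) x by (simp add: sum.reindex)
    finally show ?thesis .
  qed
  have "mean {xs. set xs \<subseteq> Pow A \<and> length xs = Suc 0}
           (\<lambda>xs. zeta q (\<Sum>k\<in>K. c k * (\<Prod>j<Suc 0. h k j (xs ! j))))
      = mean (Pow A) (\<lambda>x. zeta q (\<Sum>k\<in>K. c k * h k 0 x))"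
    using assms(1) by (subst mean_lists_Suc) (auto simp: mean_def cong: conj_cong)
  also have "\<dots> = mean (Pow A) (\<lambda>x. zeta q c0 * (\<Prod>a\<in>A. zeta q (c (\<kappa> a) * of_bool (a \<in> x))))"
    by (rule mean_cong) (simp only: split zeta_add zeta_sum)
  also have "\<dots> = zeta q c0 * mean (Pow A) (\<lambda>x. \<Prod>a\<in>A. zeta q (c (\<kappa> a) * of_bool (a \<in> x)))"
    by (simp add: mean_def sum_distrib_left)
  also have "\<dots> = zeta q c0 * (\<Prod>a\<in>A. (zeta q (c (\<kappa> a)) + 1) / 2)"
    using mean_Pow_prod[OF assms(1), of "\<lambda>a b. zeta q (c (\<kappa> a) * of_bool b)"] by simp
  finally have "norm (mean {xs. set xs \<subseteq> Pow A \<and> length xs = Suc 0}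
           (\<lambda>xs. zeta q (\<Sum>k\<in>K. c k * (\<Prod>j<Suc 0. h k j (xs ! j)))))
      = (\<Prod>a\<in>A. norm ((zeta q (c (\<kappa> a)) + 1) / 2))"
    by (simp only: norm_mult norm_zeta mult_1 prod_norm)
  then have "norm (mean {xs. set xs \<subseteq> Pow A \<and> length xs = Suc 0}
           (\<lambda>xs. zeta q (\<Sum>k\<in>K. c k * (\<Prod>j<Suc 0. h k j (xs ! j))))) ^ 2
      = (\<Prod>a\<in>A. (norm ((zeta q (c (\<kappa> a)) + 1) / 2))\<^sup>2)"
    by (simp only: prod_power_distrib)
  also have "\<dots> = (\<Prod>a\<in>A. decay q 1 (c (\<kappa> a)))"
    by (simp only: norm_half_1_plus_zeta)
  finally show ?case by simp
next
  case (Suc m)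
  define Y where "Y = {xs. set xs \<subseteq> Pow A \<and> length xs = Suc m}"
  define c' where "c' = (\<lambda>x y k. c k * (h k 0 x - h k 0 y))"
  define f where "f = (\<lambda>x t. \<Sum>k\<in>K. c k * (h k 0 x * (\<Prod>j<Suc m. h k (Suc j) (t ! j))))"
  have diff: "f x t - f y t = (\<Sum>k\<in>K. c' x y k * (\<Prod>j<Suc m. h k (Suc j) (t ! j)))" for x y t
    unfolding f_def c'_def sum_subtractf[symmetric] by (simp only: algebra_simps)
  have IH: "norm (mean Y (\<lambda>t. zeta q (f x t - f y t))) ^ (2 ^ Suc m)
      \<le> (\<Prod>a\<in>A. decay q (Suc m) (c (\<kappa> a) * (of_bool (a \<in> x) - of_bool (a \<in> y))))"
    if xy: "x \<in> Pow A" "y \<in> Pow A" for x y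
  proof -
    have "norm (mean Y (\<lambda>t. zeta q (f x t - f y t))) ^ (2 ^ Suc m)
        \<le> (\<Prod>a\<in>A. decay q (Suc m) (c' x y (\<kappa> a)))"
      unfolding diff Y_def
    proof (rule Suc.IH)
      fix a j x assume "a \<in> A" "j < Suc m" "x \<subseteq> A"
      then show "h (\<kappa> a) (Suc j) x = of_bool (a \<in> x)" by (intro Suc.prems) auto
    next
      fix k assume "k \<in> K - \<kappa> ` A"
      then consider "c k = 0" | j where "j < Suc (Suc m)" "\<forall>x\<in>Pow A. \<forall>y\<in>Pow A. h k j x = h k j y"
        using Suc.prems(2) by blast
      then show "c' x y k = 0 \<or> (\<exists>j<Suc m. \<forall>x\<in>Pow A. \<forall>y\<in>Pow A. h k (Suc j) x = h k (Suc j) y)"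
      proof cases
        case 1
        then show ?thesis by (simp add: c'_def)
      next
        case (2 j)
        show ?thesis
        proof (cases j)
          case 0
          then have "h k 0 x = h k 0 y" using 2(2) xy by blast
          then show ?thesis by (simp add: c'_def)
        next
          case (Suc j')
          then show ?thesis using 2 by blast
        qed
      qed
    qed
    also have "\<dots> = (\<Prod>a\<in>A. decay q (Suc m) (c (\<kappa> a) * (of_bool (a \<in> x) - of_bool (a \<in> y))))"
      by (rule prod.cong) (use Suc.prems(1) xy in \<open>auto simp: c'_def\<close>)
    finally show ?thesis .
  qed
  have "mean {xs. set xs \<subseteq> Pow A \<and> length xs = Suc (Suc m)}
           (\<lambda>xs. zeta q (\<Sum>k\<in>K. c k * (\<Prod>j<Suc (Suc m). h k j (xs ! j))))
      = mean (Pow A) (\<lambda>x. mean Y (\<lambda>t. zeta q (f x t)))"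
    unfolding Y_def using assms(1)
    by (subst mean_lists_Suc) (simp_all add: f_def prod.lessThan_Suc_shift del: prod.lessThan_Suc)
  then have "norm (mean {xs. set xs \<subseteq> Pow A \<and> length xs = Suc (Suc m)}
           (\<lambda>xs. zeta q (\<Sum>k\<in>K. c k * (\<Prod>j<Suc (Suc m). h k j (xs ! j))))) ^ (2 ^ Suc (Suc m))
      = ((norm (mean (Pow A) (\<lambda>x. mean Y (\<lambda>t. zeta q (f x t)))))\<^sup>2) ^ (2 ^ Suc m)"
    by (simp add: power_mult[symmetric])
  also have "\<dots> \<le> (mean (Pow A) (\<lambda>x. mean (Pow A) (\<lambda>y. norm (mean Y (\<lambda>t. zeta q (f x t - f y t)))))) ^ (2 ^ Suc m)"
    by (intro power_mono van_der_corput) simp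
  also have "\<dots> \<le> mean (Pow A) (\<lambda>x. (mean (Pow A) (\<lambda>y. norm (mean Y (\<lambda>t. zeta q (f x t - f y t))))) ^ (2 ^ Suc m))"
    by (intro mean_power_two_power_le mean_nonneg) simp
  also have "\<dots> \<le> mean (Pow A) (\<lambda>x. mean (Pow A) (\<lambda>y. norm (mean Y (\<lambda>t. zeta q (f x t - f y t))) ^ (2 ^ Suc m)))"
    by (intro mean_mono mean_power_two_power_le) simp
  also have "\<dots> \<le> mean (Pow A) (\<lambda>x. mean (Pow A) (\<lambda>y.
       \<Prod>a\<in>A. decay q (Suc m) (c (\<kappa> a) * (of_bool (a \<in> x) - of_bool (a \<in> y)))))"
    by (intro mean_mono IH)
  also have "\<dots> = mean (Pow A) (\<lambda>x. \<Prod>a\<in>A.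
       (decay q (Suc m) (c (\<kappa> a) * (of_bool (a \<in> x) - 1)) + decay q (Suc m) (c (\<kappa> a) * of_bool (a \<in> x))) / 2)"
    by (rule mean_cong, subst mean_Pow_prod[OF assms(1), of "\<lambda>a b. decay q (Suc m) (c (\<kappa> a) * (of_bool (a \<in> _) - of_bool b))"]) simp
  also have "\<dots> = (\<Prod>a\<in>A. decay q (Suc (Suc m)) (c (\<kappa> a)))"
    using mean_Pow_prod[OF assms(1), of "\<lambda>a b. (decay q (Suc m) (c (\<kappa> a) * (of_bool b - 1)) + decay q (Suc m) (c (\<kappa> a) * of_bool b)) / 2"]
    by (simp add: decay_Suc[of q "Suc m"] algebra_simps add_divide_distrib)
  finally show ?case .
qed

section \<open>Graphs, isomorphism and density\<close>

lemma edgesE: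
  assumes "finite_simple_graph G" "e \<in> edges G"
  obtains u v where "e = {u, v}" "u \<in> verts G" "v \<in> verts G" "u \<noteq> v"
  using assms unfolding finite_simple_graph_def by (meson nsets2_E subsetD)

lemma edges_subset_verts: "finite_simple_graph G \<Longrightarrow> e \<in> edges G \<Longrightarrow> e \<subseteq> verts G"
  by (auto elim!: edgesE)

lemma finite_edges: "finite_simple_graph G \<Longrightarrow> finite (edges G)"
  unfolding finite_simple_graph_def using finite_imp_finite_nsets finite_subset by blast

lemma graph_isoE:
  assumes "finite_simple_graph G" "finite_simple_graph H" "graph_iso G H"
  obtains f where "bij_betw f (verts G) (verts H)" "edges H = (\<lambda>e. f ` e) ` edges G"
proof -
  from assms(3) obtain f where f: "bij_betw f (verts G) (verts H)"
    and E: "\<And>u v. u \<in> verts G \<Longrightarrow> v \<in> verts G \<Longrightarrow> {u, v} \<in> edges G \<longleftrightarrow> {f u, f v} \<in> edges H"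
    unfolding graph_iso_def by blast
  have "edges H = (\<lambda>e. f ` e) ` edges G"
  proof (intro equalityI subsetI)
    fix e assume e: "e \<in> edges H"
    then obtain x y where xy: "e = {x, y}" "x \<in> verts H" "y \<in> verts H"
      using edgesE[OF assms(2)] by metis
    then obtain u v where uv: "u \<in> verts G" "v \<in> verts G" "x = f u" "y = f v"
      using f by (metis bij_betw_imp_surj_on imageE)
    then have "{u, v} \<in> edges G" using E e xy by simp
    then show "e \<in> (\<lambda>e. f ` e) ` edges G" using uv xy by (auto intro!: image_eqI[of _ _ "{u, v}"])
  next
    fix e assume "e \<in> (\<lambda>e. f ` e) ` edges G"
    then obtain e' where e': "e' \<in> edges G" "e = f ` e'" by blast
    then obtain u v where "e' = {u, v}" "u \<in> verts G" "v \<in> verts G"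
      using edgesE[OF assms(1)] by metis
    then show "e \<in> edges H" using E e' by simp
  qed
  with f that show ?thesis by blast
qed

lemma graph_isoI:
  assumes "finite_simple_graph G" "bij_betw f (verts G) (verts H)" "edges H = (\<lambda>e. f ` e) ` edges G"
  shows "graph_iso G H"
  unfolding graph_iso_def
proof (intro exI[of _ f] conjI ballI assms(2))
  fix u v assume uv: "u \<in> verts G" "v \<in> verts G"
  show "{u, v} \<in> edges G \<longleftrightarrow> {f u, f v} \<in> edges H"
  proof
    assume "{u, v} \<in> edges G"
    then show "{f u, f v} \<in> edges H" unfolding assms(3) by (auto intro!: image_eqI[of _ _ "{u, v}"])
  next
    assume "{f u, f v} \<in> edges H"
    then obtain e where e: "e \<in> edges G" "f ` {u, v} = f ` e" unfolding assms(3) by auto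
    moreover have "{u, v} \<subseteq> verts G" "e \<subseteq> verts G"
      using uv edges_subset_verts[OF assms(1) e(1)] by auto
    ultimately have "{u, v} = e"
      using assms(2) by (metis bij_betw_def inj_on_image_eq_iff)
    with e show "{u, v} \<in> edges G" by simp
  qed
qed

lemma graph_iso_trans: "graph_iso G H \<Longrightarrow> graph_iso H K \<Longrightarrow> graph_iso G K"
proof -
  assume "graph_iso G H" "graph_iso H K"
  then obtain f g where f: "bij_betw f (verts G) (verts H)"
    and E: "\<And>u v. u \<in> verts G \<Longrightarrow> v \<in> verts G \<Longrightarrow> {u, v} \<in> edges G \<longleftrightarrow> {f u, f v} \<in> edges H"
    and g: "bij_betw g (verts H) (verts K)"
    and E': "\<And>u v. u \<in> verts H \<Longrightarrow> v \<in> verts H \<Longrightarrow> {u, v} \<in> edges H \<longleftrightarrow> {g u, g v} \<in> edges K"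
    unfolding graph_iso_def by blast
  have "f u \<in> verts H" if "u \<in> verts G" for u using f that bij_betwE by blast
  then show ?thesis unfolding graph_iso_def
    by (intro exI[of _ "g \<circ> f"]) (auto simp: E E' intro: bij_betw_trans[OF f g])
qed

lemma graph_iso_sym: "graph_iso G H \<Longrightarrow> graph_iso H G"
proof -
  assume "graph_iso G H"
  then obtain f where f: "bij_betw f (verts G) (verts H)"
    and E: "\<And>u v. u \<in> verts G \<Longrightarrow> v \<in> verts G \<Longrightarrow> {u, v} \<in> edges G \<longleftrightarrow> {f u, f v} \<in> edges H"
    unfolding graph_iso_def by blast
  define g where "g = inv_into (verts G) f"
  have g: "bij_betw g (verts H) (verts G)" unfolding g_def by (rule bij_betw_inv_into[OF f])
  have "g x \<in> verts G" "f (g x) = x" if "x \<in> verts H" for x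
    using g that f by (auto simp: g_def bij_betw_inv_into_right dest: bij_betwE)
  then show ?thesis unfolding graph_iso_def
    by (intro exI[of _ g]) (use g in \<open>auto simp: E\<close>)
qed

lemma card_edges_iso:
  assumes "finite_simple_graph G" "finite_simple_graph H" "graph_iso G H"
  shows "card (edges H) = card (edges G)"
proof -
  obtain f where f: "bij_betw f (verts G) (verts H)" "edges H = (\<lambda>e. f ` e) ` edges G"
    using graph_isoE[OF assms] by blast
  have "inj_on (\<lambda>e. f ` e) (Pow (verts G))"
    using f(1) by (simp add: bij_betw_def inj_on_image_Pow)
  then have "inj_on (\<lambda>e. f ` e) (edges G)"
    by (rule inj_on_subset) (use edges_subset_verts[OF assms(1)] in blast)
  then show ?thesis using f(2) by (simp add: card_image)
qed

lemma connected_graph_iso: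
  assumes "finite_simple_graph G" "connected_graph G" "graph_iso K G"
  shows "connected_graph K"
proof -
  from assms(3) obtain f where f: "bij_betw f (verts K) (verts G)"
    and E: "\<And>u v. u \<in> verts K \<Longrightarrow> v \<in> verts K \<Longrightarrow> {u, v} \<in> edges K \<longleftrightarrow> {f u, f v} \<in> edges G"
    unfolding graph_iso_def by blast
  define g where "g = inv_into (verts K) f"
  have g: "g x \<in> verts K" "f (g x) = x" if "x \<in> verts G" for x
    using that f bij_betw_inv_into[OF f] by (auto simp: g_def bij_betw_inv_into_right dest: bij_betwE)
  have gf: "g (f u) = u" if "u \<in> verts K" for u
    using that f by (simp add: g_def bij_betw_inv_into_left)
  have "verts K \<noteq> {}"
    using f assms(2) unfolding connected_graph_def bij_betw_def by auto
  moreover have "(u, v) \<in> {(x, y). {x, y} \<in> edges K}\<^sup>*" if uv: "u \<in> verts K" "v \<in> verts K" for u v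
  proof -
    have "f u \<in> verts G" "f v \<in> verts G" using f uv bij_betwE by blast+
    then have "(f u, f v) \<in> {(x, y). {x, y} \<in> edges G}\<^sup>*"
      using assms(2) unfolding connected_graph_def by blast
    then have "(u, g (f v)) \<in> {(x, y). {x, y} \<in> edges K}\<^sup>*"
    proof (induction rule: rtrancl_induct)
      case base
      then show ?case using gf uv by simp
    next
      case (step y z)
      then have yz: "{y, z} \<in> edges G" by simp
      then have "y \<in> verts G" "z \<in> verts G" using edges_subset_verts[OF assms(1)] by auto
      then have "{g y, g z} \<in> edges K" using yz E g by simp
      with step.IH show ?case by (auto intro: rtrancl_into_rtrancl)
    qed
    then show ?thesis using gf uv by simp
  qed
  ultimately show ?thesis unfolding connected_graph_def by blast
qed

text \<open>A copy is therefore determined by its edge set.\<close>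
lemma Union_edges_connected:
  assumes "finite_simple_graph G" "connected_graph G" "card (verts G) \<ge> 2"
  shows "\<Union> (edges G) = verts G"
proof
  show "\<Union> (edges G) \<subseteq> verts G" using edges_subset_verts[OF assms(1)] by blast
  show "verts G \<subseteq> \<Union> (edges G)"
  proof
    fix v assume v: "v \<in> verts G"
    have "verts G \<noteq> {v}" using assms(3) by auto
    then obtain u where u: "u \<in> verts G" "u \<noteq> v" using v by blast
    have "(v, u) \<in> {(x, y). {x, y} \<in> edges G}\<^sup>*"
      using assms(2) u v unfolding connected_graph_def by blast
    then obtain y where "{v, y} \<in> edges G" using u(2) by (auto elim: converse_rtranclE)
    then show "v \<in> \<Union> (edges G)" by blast
  qed
qed

lemma connected_constant:
  assumes "connected_graph G" "\<And>x y. {x, y} \<in> edges G \<Longrightarrow> \<beta> x = \<beta> y"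
    and "u \<in> verts G" "v \<in> verts G"
  shows "\<beta> u = \<beta> v"
proof -
  have "(u, v) \<in> {(x, y). {x, y} \<in> edges G}\<^sup>*"
    using assms unfolding connected_graph_def by blast
  then show ?thesis by (induction rule: rtrancl_induct) (auto dest: assms(2))
qed

lemma finite_densities:
  assumes "finite_simple_graph H"
  shows "finite {density H' | H'. subgraph H' H \<and> card (verts H') > 0}"
proof -
  have "{density H' | H'. subgraph H' H \<and> card (verts H') > 0} \<subseteq> density ` (Pow (verts H) \<times> Pow (edges H))"
    by (auto simp: subgraph_def mem_Times_iff)
  moreover have "finite (Pow (verts H) \<times> Pow (edges H))"
    using assms finite_edges[OF assms] by (auto simp: finite_simple_graph_def)
  ultimately show ?thesis by (meson finite_imageI finite_subset)
qed

text \<open>The expected number of copies of any nonempty induced subgraph tends to infinity: its number of vertices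
beats \<open>\<alpha>\<close> times its number of edges.\<close>
lemma edges_inside_less:
  assumes "finite_simple_graph H" "\<alpha> > 0" "max_density H < inverse \<alpha>" "D \<subseteq> verts H" "D \<noteq> {}"
  shows "\<alpha> * real (card {e \<in> edges H. e \<subseteq> D}) < real (card D)"
proof -
  define H' where "H' = (D, {e \<in> edges H. e \<subseteq> D})"
  have fin: "finite D" using assms finite_subset by (auto simp: finite_simple_graph_def)
  have "subgraph H' H"
    using assms fin unfolding subgraph_def finite_simple_graph_def H'_def
    by (auto simp: nsets_def)
  moreover have pos: "card D > 0" using fin assms(5) by (simp add: card_gt_0_iff)
  ultimately have "density H' \<le> max_density H"
    unfolding max_density_def by (intro Max_ge finite_densities assms(1)) (auto simp: H'_def)
  then have "real (card {e \<in> edges H. e \<subseteq> D}) / real (card D) < inverse \<alpha>"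
    using assms(3) by (simp add: density_def H'_def)
  then show ?thesis using pos assms(2) by (simp add: field_simps)
qed

lemma densest_subgraph:
  assumes "finite_simple_graph H" "verts H \<noteq> {}"
  obtains H' where "subgraph H' H" "card (verts H') > 0" "density H' = max_density H"
proof -
  have "subgraph H H" using assms by (simp add: subgraph_def)
  moreover have "card (verts H) > 0" using assms by (simp add: finite_simple_graph_def card_gt_0_iff)
  ultimately have "{density H' | H'. subgraph H' H \<and> card (verts H') > 0} \<noteq> {}" by blast
  from Max_in[OF finite_densities[OF assms(1)] this] that show ?thesis
    unfolding max_density_def by auto
qed

definition copies :: "nat \<Rightarrow> 'a graph \<Rightarrow> nat graph set" where
  "copies n H = {S. subgraph S ({..<n}, [{..<n}]\<^bsup>2\<^esup>) \<and> graph_iso S H}"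

lemma finite_copies: "finite (copies n H)"
proof -
  have "copies n H \<subseteq> Pow {..<n} \<times> Pow ([{..<n}]\<^bsup>2\<^esup>)"
    by (auto simp: copies_def subgraph_def mem_Times_iff)
  then show ?thesis
    by (rule finite_subset) (simp add: finite_imp_finite_nsets)
qed

text \<open>The count is a sum of monomials in the edge indicators, indexed by the potential copies.\<close>
lemma num_copies_eq_sum:
  assumes "R \<subseteq> [{..<n}]\<^bsup>2\<^esup>"
  shows "int (num_copies ({..<n}, R) H) = (\<Sum>S\<in>copies n H. of_bool (edges S \<subseteq> R))"
proof -
  have "{S. subgraph S ({..<n}, R) \<and> graph_iso S H} = {S \<in> copies n H. edges S \<subseteq> R}"
    using assms by (auto simp: copies_def subgraph_def)
  then show ?thesis
    by (simp add: num_copies_def finite_copies Int_def)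
qed

section \<open>Placements of disjoint copies and their overlaps\<close>

text \<open>Each vertex \<open>x\<close> has its own block of \<open>N\<close> consecutive numbers, and \<open>\<pi> x\<close> is an offset in that block.
So every choice of offsets is an injective placement, and two placements can only meet in vertices
where they agree. Random placements have independent coordinates, which makes overlaps easy to
count.\<close>
definition spot :: "nat \<Rightarrow> ('u \<Rightarrow> nat) \<Rightarrow> ('u \<Rightarrow> nat) \<Rightarrow> 'u \<Rightarrow> nat" where
  "spot N \<iota> \<pi> x = \<iota> x * N + \<pi> x"

text \<open>A slot \<open>(e, a)\<close> stands for the edge \<open>e\<close> in the \<open>a\<close>-th of several disjoint copies of a graph.\<close>
definition plant :: "nat \<Rightarrow> ('a \<times> nat \<Rightarrow> nat) \<Rightarrow> ('a \<times> nat \<Rightarrow> nat) \<Rightarrow> 'a set \<times> nat \<Rightarrow> nat set" where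
  "plant N \<iota> \<pi> s = spot N \<iota> \<pi> ` (fst s \<times> {snd s})"

abbreviation placements :: "'u set \<Rightarrow> nat \<Rightarrow> ('u \<Rightarrow> nat) set" where
  "placements U N \<equiv> (\<Pi>\<^sub>E x\<in>U. {..<N})"

lemma spot_eq_iff:
  assumes "inj_on \<iota> U" "x \<in> U" "y \<in> U" "\<pi> x < N" "\<pi>' y < N"
  shows "spot N \<iota> \<pi> x = spot N \<iota> \<pi>' y \<longleftrightarrow> x = y \<and> \<pi> x = \<pi>' y"
proof
  assume "spot N \<iota> \<pi> x = spot N \<iota> \<pi>' y"
  then have eq: "\<iota> x * N + \<pi> x = \<iota> y * N + \<pi>' y" by (simp add: spot_def)
  then have "(\<iota> x * N + \<pi> x) div N = (\<iota> y * N + \<pi>' y) div N" by simp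
  then have "\<iota> x = \<iota> y" using assms(4,5) by simp
  then show "x = y \<and> \<pi> x = \<pi>' y" using eq assms(1-3) by (auto dest: inj_onD)
qed (auto simp: spot_def)

lemma plant_eqD:
  assumes "inj_on \<iota> U" "\<pi> \<in> placements U N" "\<pi>' \<in> placements U N"
    and "fst s \<times> {snd s} \<subseteq> U" "fst s \<noteq> {}" "fst s' \<times> {snd s'} \<subseteq> U"
    and eq: "plant N \<iota> \<pi> s = plant N \<iota> \<pi>' s'"
  shows "s = s'" "\<And>x. x \<in> fst s \<times> {snd s} \<Longrightarrow> \<pi> x = \<pi>' x"
proof -
  have lt: "\<pi> x < N" "\<pi>' x < N" if "x \<in> U" for x
    using that assms(2,3) by (auto dest: PiE_mem)
  have 1: "x \<in> fst s' \<times> {snd s'} \<and> \<pi> x = \<pi>' x" if x: "x \<in> fst s \<times> {snd s}" for x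
  proof -
    have "spot N \<iota> \<pi> x \<in> plant N \<iota> \<pi>' s'" using x eq by (auto simp: plant_def)
    then obtain y where y: "y \<in> fst s' \<times> {snd s'}" "spot N \<iota> \<pi> x = spot N \<iota> \<pi>' y"
      by (auto simp: plant_def)
    moreover have "x \<in> U" "y \<in> U" using x y assms(4,6) by blast+
    ultimately have "x = y \<and> \<pi> x = \<pi>' y" using spot_eq_iff[OF assms(1)] lt by blast
    with y show ?thesis by blast
  qed
  then show "\<And>x. x \<in> fst s \<times> {snd s} \<Longrightarrow> \<pi> x = \<pi>' x" by blast
  have 2: "x \<in> fst s \<times> {snd s}" if x: "x \<in> fst s' \<times> {snd s'}" for x
  proof -
    have "spot N \<iota> \<pi>' x \<in> plant N \<iota> \<pi> s" using x eq by (auto simp: plant_def)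
    then obtain y where y: "y \<in> fst s \<times> {snd s}" "spot N \<iota> \<pi>' x = spot N \<iota> \<pi> y"
      by (auto simp: plant_def)
    moreover have "x \<in> U" "y \<in> U" using x y assms(4,6) by blast+
    ultimately have "x = y" using spot_eq_iff[OF assms(1)] lt by blast
    with y show ?thesis by blast
  qed
  from 1 2 have eq': "fst s \<times> {snd s} = fst s' \<times> {snd s'}" by blast
  with assms(5) have "fst s = fst s'" "snd s = snd s'"
    unfolding times_eq_iff by auto
  then show "s = s'" by (rule prod_eqI)
qed

text \<open>The planted patterns at \<open>\<pi>\<close> and \<open>\<pi>'\<close> share only edges inside the set \<open>D\<close> of vertices on which \<open>\<pi>\<close> and
\<open>\<pi>'\<close> agree, and two random placements agree on a given \<open>D\<close> with probability \<open>N\<close> to the power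
\<open>- card D\<close>. The union bound over \<open>D\<close> gives the estimate.\<close>
lemma plant_overlap:
  fixes U :: "('a \<times> nat) set"
  assumes U: "finite U" "inj_on \<iota> U" and N: "N > 0" and p: "0 < p" "p < 1"
    and T: "finite T" "\<And>s. s \<in> T \<Longrightarrow> fst s \<times> {snd s} \<subseteq> U" "\<And>s. s \<in> T \<Longrightarrow> fst s \<noteq> {}"
  shows "mean (placements U N) (\<lambda>\<pi>. mean (placements U N)
           (\<lambda>\<pi>'. inverse p ^ card (plant N \<iota> \<pi> ` T \<inter> plant N \<iota> \<pi>' ` T)))
     \<le> (\<Sum>D\<in>Pow U. inverse p ^ card {s \<in> T. fst s \<times> {snd s} \<subseteq> D} / real N ^ card D)"
proof -
  define L where "L = placements U N"
  have L: "finite L" "L \<noteq> {}" "card L = N ^ card U"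
    using U N by (auto simp: L_def finite_PiE PiE_eq_empty_iff card_PiE)
  define e where "e = (\<lambda>D. card {s \<in> T. fst s \<times> {snd s} \<subseteq> D})"
  have ip: "inverse p \<ge> 1" using p by (simp add: one_le_inverse)
  have inner: "mean L (\<lambda>\<pi>'. inverse p ^ card (plant N \<iota> \<pi> ` T \<inter> plant N \<iota> \<pi>' ` T))
      \<le> (\<Sum>D\<in>Pow U. inverse p ^ e D / real N ^ card D)" if \<pi>: "\<pi> \<in> L" for \<pi>
  proof -
    have "inverse p ^ card (plant N \<iota> \<pi> ` T \<inter> plant N \<iota> \<pi>' ` T)
        \<le> (\<Sum>D\<in>Pow U. of_bool (\<forall>x\<in>D. \<pi> x = \<pi>' x) * inverse p ^ e D)" if \<pi>': "\<pi>' \<in> L" for \<pi>'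
    proof -
      define D where "D = {x \<in> U. \<pi> x = \<pi>' x}"
      have "plant N \<iota> \<pi> ` T \<inter> plant N \<iota> \<pi>' ` T \<subseteq> plant N \<iota> \<pi> ` {s \<in> T. fst s \<times> {snd s} \<subseteq> D}"
      proof
        fix f assume "f \<in> plant N \<iota> \<pi> ` T \<inter> plant N \<iota> \<pi>' ` T"
        then obtain s s' where s: "s \<in> T" "s' \<in> T" "f = plant N \<iota> \<pi> s" "f = plant N \<iota> \<pi>' s'"
          by blast
        have "\<pi> x = \<pi>' x" if "x \<in> fst s \<times> {snd s}" for x
          using plant_eqD(2)[OF U(2), of \<pi> N \<pi>' s s' x] \<pi> \<pi>' T s that unfolding L_def by auto
        then have "fst s \<times> {snd s} \<subseteq> D" unfolding D_def using T(2)[OF s(1)] by blast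
        then show "f \<in> plant N \<iota> \<pi> ` {s \<in> T. fst s \<times> {snd s} \<subseteq> D}" using s by blast
      qed
      then have "card (plant N \<iota> \<pi> ` T \<inter> plant N \<iota> \<pi>' ` T) \<le> e D"
        unfolding e_def using T(1)
        by (intro order.trans[OF card_mono card_image_le]) auto
      then have "inverse p ^ card (plant N \<iota> \<pi> ` T \<inter> plant N \<iota> \<pi>' ` T) \<le> of_bool (\<forall>x\<in>D. \<pi> x = \<pi>' x) * inverse p ^ e D"
        using ip by (simp add: D_def power_increasing)
      also have "\<dots> \<le> (\<Sum>D\<in>Pow U. of_bool (\<forall>x\<in>D. \<pi> x = \<pi>' x) * inverse p ^ e D)"
        by (rule member_le_sum) (use p U in \<open>auto simp: D_def\<close>)
      finally show ?thesis .
    qed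
    then have "mean L (\<lambda>\<pi>'. inverse p ^ card (plant N \<iota> \<pi> ` T \<inter> plant N \<iota> \<pi>' ` T))
        \<le> mean L (\<lambda>\<pi>'. \<Sum>D\<in>Pow U. of_bool (\<forall>x\<in>D. \<pi> x = \<pi>' x) * inverse p ^ e D)"
      by (rule mean_mono)
    also have "\<dots> = (\<Sum>D\<in>Pow U. mean L (\<lambda>\<pi>'. of_bool (\<forall>x\<in>D. \<pi> x = \<pi>' x) * inverse p ^ e D))"
      by (rule mean_sum)
    also have "\<dots> = (\<Sum>D\<in>Pow U. inverse p ^ e D / real N ^ card D)"
    proof (rule sum.cong, goal_cases)
      case (2 D)
      then have D: "D \<subseteq> U" "finite D" using U finite_subset by auto
      have "{\<pi>' \<in> L. \<forall>x\<in>D. \<pi> x = \<pi>' x} = (\<Pi>\<^sub>E x\<in>U. if x \<in> D then {\<pi> x} else {..<N})" (is "?A = ?B")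
      proof (intro equalityI subsetI)
        fix g assume "g \<in> ?A"
        then show "g \<in> ?B" unfolding L_def by (auto simp: PiE_iff)
      next
        fix g assume g: "g \<in> ?B"
        have gx: "g x \<in> (if x \<in> D then {\<pi> x} else {..<N})" if "x \<in> U" for x
          using g that by (rule PiE_mem)
        have "g x < N" if "x \<in> U" for x
          using gx[OF that] PiE_mem[OF \<pi>[unfolded L_def] that] by (simp split: if_splits)
        moreover have "\<pi> x = g x" if "x \<in> D" for x
          using gx[of x] D(1) that by auto
        moreover have "g \<in> extensional U" using g by (simp add: PiE_def)
        ultimately show "g \<in> ?A" by (simp add: L_def PiE_iff)
      qed
      then have "card {\<pi>' \<in> L. \<forall>x\<in>D. \<pi> x = \<pi>' x} = (\<Prod>x\<in>U. if x \<in> D then 1 else N)"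
        using U by (auto simp: card_PiE intro!: prod.cong)
      also have "\<dots> = N ^ card (U - D)"
        using prod.subset_diff[OF D(1) U(1), of "\<lambda>x. if x \<in> D then 1 else N"] by simp
      finally have c: "card {\<pi>' \<in> L. \<forall>x\<in>D. \<pi> x = \<pi>' x} = N ^ card (U - D)" .
      have "card U = card (U - D) + card D"
        using D U by (simp add: card_Diff_subset card_mono)
      then have cL: "real (card L) = real N ^ card (U - D) * real N ^ card D"
        by (simp add: L(3) power_add)
      have "mean L (\<lambda>\<pi>'. of_bool (\<forall>x\<in>D. \<pi> x = \<pi>' x) * inverse p ^ e D)
          = real (card {\<pi>' \<in> L. \<forall>x\<in>D. \<pi> x = \<pi>' x}) * inverse p ^ e D / real (card L)"
        using L(1) by (simp add: mean_def sum_distrib_right[symmetric] Int_def divide_inverse mult_ac)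
      then show ?case unfolding c cL using N by simp
    qed simp
    finally show ?thesis .
  qed
  have "mean L (\<lambda>\<pi>. mean L (\<lambda>\<pi>'. inverse p ^ card (plant N \<iota> \<pi> ` T \<inter> plant N \<iota> \<pi>' ` T)))
      \<le> mean L (\<lambda>\<pi>. \<Sum>D\<in>Pow U. inverse p ^ e D / real N ^ card D)"
    by (intro mean_mono inner)
  also have "\<dots> = (\<Sum>D\<in>Pow U. inverse p ^ e D / real N ^ card D)"
    using L by simp
  finally show ?thesis unfolding L_def e_def .
qed

lemma block_size_ge:
  assumes "u > 0"
  shows "eventually (\<lambda>n. real n / (2 * real u) \<le> real (n div u)) at_top"
  using eventually_ge_at_top[of u]
proof eventually_elim
  case (elim n)
  then have "n div u \<ge> 1" using assms by (simp add: div_greater_zero_iff Suc_leI)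
  moreover have "n < u * (n div u) + u"
    using assms mult_div_mod_eq[of u n] mod_less_divisor[of u n] by linarith
  moreover have "u \<le> u * (n div u)" using calculation(1) by simp
  ultimately have "n \<le> 2 * u * (n div u)" by linarith
  then have "real n \<le> real (2 * u * (n div u))"
    by (simp only: of_nat_le_iff)
  then have "real n \<le> 2 * real u * real (n div u)"
    by simp
  then show ?case using assms by (simp add: field_simps)
qed

lemma overlap_term_tendsto:
  assumes "u > 0" "\<alpha> * real e < real d"
  shows "(\<lambda>n. inverse (real n powr (- \<alpha>)) ^ e / real (n div u) ^ d) \<longlonglongrightarrow> 0"
proof (rule tendsto_sandwich[OF _ _ tendsto_const])
  show "eventually (\<lambda>n. 0 \<le> inverse (real n powr (- \<alpha>)) ^ e / real (n div u) ^ d) at_top" by simp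
  have "(\<lambda>n. (2 * real u) ^ d * real n powr (\<alpha> * real e - real d)) \<longlonglongrightarrow> (2 * real u) ^ d * 0"
    by (intro tendsto_mult tendsto_const tendsto_neg_powr filterlim_real_sequentially) (use assms in auto)
  then show "(\<lambda>n. (2 * real u) ^ d * real n powr (\<alpha> * real e - real d)) \<longlonglongrightarrow> 0" by simp
  show "eventually (\<lambda>n. inverse (real n powr (- \<alpha>)) ^ e / real (n div u) ^ d
          \<le> (2 * real u) ^ d * real n powr (\<alpha> * real e - real d)) at_top"
    using block_size_ge[OF assms(1)] eventually_gt_at_top[of 0]
  proof eventually_elim
    case (elim n)
    have "inverse (real n powr (- \<alpha>)) ^ e = real n powr (\<alpha> * real e)"
      using elim by (simp add: powr_minus powr_powr[symmetric] powr_realpow)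
    moreover have "(real n / (2 * real u)) ^ d \<le> real (n div u) ^ d"
      using elim by (intro power_mono) auto
    moreover have "(real n / (2 * real u)) ^ d > 0" using elim assms(1) by simp
    ultimately have "inverse (real n powr (- \<alpha>)) ^ e / real (n div u) ^ d
        \<le> real n powr (\<alpha> * real e) / (real n / (2 * real u)) ^ d"
      by (simp add: frac_le)
    also have "\<dots> = (2 * real u) ^ d * real n powr (\<alpha> * real e - real d)"
      using elim by (simp add: powr_diff powr_realpow power_divide)
    finally show ?case .
  qed
qed

text \<open>Only the empty overlap survives in the limit, so the second moment tends to \<open>1\<close>.\<close>
lemma overlap_sum_tendsto:
  fixes U :: "'u set"
  assumes "finite U" "u > 0" "e {} = 0"
    and "\<And>D. D \<subseteq> U \<Longrightarrow> D \<noteq> {} \<Longrightarrow> \<alpha> * real (e D) < real (card D)"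
  shows "(\<lambda>n. \<Sum>D\<in>Pow U. inverse (real n powr (- \<alpha>)) ^ e D / real (n div u) ^ card D) \<longlonglongrightarrow> 1"
proof -
  have "(\<lambda>n. \<Sum>D\<in>Pow U. inverse (real n powr (- \<alpha>)) ^ e D / real (n div u) ^ card D)
      \<longlonglongrightarrow> (\<Sum>D\<in>Pow U. if D = {} then 1 else 0)"
  proof (intro tendsto_sum)
    fix D assume "D \<in> Pow U"
    then show "(\<lambda>n. inverse (real n powr (- \<alpha>)) ^ e D / real (n div u) ^ card D)
        \<longlonglongrightarrow> (if D = {} then 1 else 0)"
      using assms overlap_term_tendsto[OF assms(2), of \<alpha> "e D" "card D"] by auto
  qed
  then show ?thesis using assms(1) by (simp add: sum.delta)
qed

text \<open>The density condition on a graph passes to disjoint unions of its copies, since both sides are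
additive over the copies.\<close>
lemma slots_inside_less:
  assumes H: "finite_simple_graph H" "\<alpha> > 0" "max_density H < inverse \<alpha>"
    and D: "D \<subseteq> verts H \<times> {..<M::nat}" "D \<noteq> {}" and T: "T \<subseteq> edges H \<times> {..<M}"
  shows "\<alpha> * real (card {s \<in> T. fst s \<times> {snd s} \<subseteq> D}) < real (card D)"
proof -
  define D' where "D' = (\<lambda>a. {v. (v, a) \<in> D})"
  have D': "D' a \<subseteq> verts H" for a using D(1) by (auto simp: D'_def)
  have finV: "finite (verts H)" using H(1) by (simp add: finite_simple_graph_def)
  have finD': "finite (D' a)" for a using D' finV finite_subset by blast
  have finE: "finite {e \<in> edges H. e \<subseteq> D' a}" for a using finite_edges[OF H(1)] by simp
  have "D = (\<lambda>(a, v). (v, a)) ` (SIGMA a:{..<M}. D' a)"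
  proof (intro equalityI subsetI)
    fix x assume "x \<in> D"
    then have "(snd x, fst x) \<in> (SIGMA a:{..<M}. D' a)" using D(1) by (auto simp: D'_def)
    then show "x \<in> (\<lambda>(a, v). (v, a)) ` (SIGMA a:{..<M}. D' a)" by (rule rev_image_eqI) simp
  qed (auto simp: D'_def)
  also have "card \<dots> = card (SIGMA a:{..<M}. D' a)"
    by (rule card_image) (auto simp: inj_on_def)
  also have "\<dots> = (\<Sum>a<M. card (D' a))"
    using finD' by (intro card_SigmaI) auto
  finally have cD: "card D = (\<Sum>a<M. card (D' a))" .
  have "{s \<in> T. fst s \<times> {snd s} \<subseteq> D} \<subseteq> (\<lambda>(a, e). (e, a)) ` (SIGMA a:{..<M}. {e \<in> edges H. e \<subseteq> D' a})"
  proof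
    fix s assume s: "s \<in> {s \<in> T. fst s \<times> {snd s} \<subseteq> D}"
    then have "(snd s, fst s) \<in> (SIGMA a:{..<M}. {e \<in> edges H. e \<subseteq> D' a})"
      using T by (auto simp: D'_def)
    then show "s \<in> (\<lambda>(a, e). (e, a)) ` (SIGMA a:{..<M}. {e \<in> edges H. e \<subseteq> D' a})"
      by (rule rev_image_eqI) simp
  qed
  then have "card {s \<in> T. fst s \<times> {snd s} \<subseteq> D} \<le> card (SIGMA a:{..<M}. {e \<in> edges H. e \<subseteq> D' a})"
    using finE by (intro order.trans[OF card_mono card_image_le]) auto
  also have "\<dots> = (\<Sum>a<M. card {e \<in> edges H. e \<subseteq> D' a})"
    using finE by (intro card_SigmaI) auto
  finally have "\<alpha> * real (card {s \<in> T. fst s \<times> {snd s} \<subseteq> D})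
      \<le> \<alpha> * real (\<Sum>a<M. card {e \<in> edges H. e \<subseteq> D' a})"
    using H(2) by (intro mult_left_mono of_nat_mono) auto
  also have "\<dots> = (\<Sum>a<M. \<alpha> * real (card {e \<in> edges H. e \<subseteq> D' a}))"
    by (simp add: sum_distrib_left)
  also have "\<dots> < (\<Sum>a<M. real (card (D' a)))"
  proof (rule sum_strict_mono_ex1)
    have emp: "{e \<in> edges H. e \<subseteq> {}} = {}"
      using edgesE[OF H(1), of "{}"] by auto
    have less: "\<alpha> * real (card {e \<in> edges H. e \<subseteq> D' a}) < real (card (D' a))" if "D' a \<noteq> {}" for a
      using edges_inside_less[OF H D' that] .
    show "\<forall>a\<in>{..<M}. \<alpha> * real (card {e \<in> edges H. e \<subseteq> D' a}) \<le> real (card (D' a))"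
    proof
      fix a show "\<alpha> * real (card {e \<in> edges H. e \<subseteq> D' a}) \<le> real (card (D' a))"
      proof (cases "D' a = {}")
        case True
        then show ?thesis by (simp only: emp card.empty)
      qed (simp add: less less_imp_le)
    qed
    from D obtain v a where "(v, a) \<in> D" by auto
    then have "a \<in> {..<M}" "D' a \<noteq> {}" using D(1) by (auto simp: D'_def)
    then show "\<exists>a\<in>{..<M}. \<alpha> * real (card {e \<in> edges H. e \<subseteq> D' a}) < real (card (D' a))"
      using less by blast
  qed simp
  also have "\<dots> = real (card D)" by (simp add: cD)
  finally show ?thesis .
qed

section \<open>The phase as a function of the planted pattern\<close>

text \<open>The pattern in which the \<open>j\<close>-th edge is present exactly in the copies listed in the \<open>j\<close>-th set.\<close>
definition slots :: "'a set list \<Rightarrow> nat set list \<Rightarrow> ('a set \<times> nat) set" where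
  "slots es xs = {(es ! j, a) | j a. j < length es \<and> a \<in> xs ! j}"

lemma slots_subset:
  assumes "set xs \<subseteq> Pow {..<M}" "length xs = length es"
  shows "slots es xs \<subseteq> set es \<times> {..<M}"
proof
  fix s assume "s \<in> slots es xs"
  then obtain j a where j: "s = (es ! j, a)" "j < length es" "a \<in> xs ! j" by (auto simp: slots_def)
  have "xs ! j \<in> set xs" using j(2) assms(2) by simp
  then have "a < M" using assms(1) j(3) by blast
  then show "s \<in> set es \<times> {..<M}" using nth_mem[OF j(2)] j(1) by simp
qed

lemma prod_of_bool: "finite A \<Longrightarrow> (\<Prod>j\<in>A. of_bool (P j)) = (of_bool (\<forall>j\<in>A. P j) :: int)"
  by (induction A rule: finite_induct) auto

text \<open>A placement of \<open>M\<close> disjoint copies of \<open>H\<close> into the vertex set \<open>{..<n}\<close>.\<close>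
locale planting =
  fixes H :: "'a graph" and M N n :: nat and \<iota> \<pi> :: "'a \<times> nat \<Rightarrow> nat"
  assumes H: "finite_simple_graph H"
    and \<iota>: "inj_on \<iota> (verts H \<times> {..<M})"
    and \<pi>: "\<pi> \<in> placements (verts H \<times> {..<M}) N"
    and small: "\<And>x. x \<in> verts H \<times> {..<M} \<Longrightarrow> \<iota> x * N + N \<le> n"
begin

definition planted_copy :: "nat \<Rightarrow> nat graph" where
  "planted_copy a = (spot N \<iota> \<pi> ` (verts H \<times> {a}), (\<lambda>e. plant N \<iota> \<pi> (e, a)) ` edges H)"

lemma inj_spot: "inj_on (spot N \<iota> \<pi>) (verts H \<times> {..<M})"
proof (rule inj_onI)
  fix x y assume "x \<in> verts H \<times> {..<M}" "y \<in> verts H \<times> {..<M}" "spot N \<iota> \<pi> x = spot N \<iota> \<pi> y"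
  then show "x = y" using spot_eq_iff[OF \<iota>, of x y \<pi> N \<pi>] PiE_mem[OF \<pi>] by blast
qed

lemma spot_less: "x \<in> verts H \<times> {..<M} \<Longrightarrow> spot N \<iota> \<pi> x < n"
  using small[of x] PiE_mem[OF \<pi>, of x] by (auto simp: spot_def)

lemma slot_subset: "s \<in> edges H \<times> {..<M} \<Longrightarrow> fst s \<times> {snd s} \<subseteq> verts H \<times> {..<M}"
  using edges_subset_verts[OF H, of "fst s"] by auto

lemma inj_plant: "inj_on (plant N \<iota> \<pi>) (edges H \<times> {..<M})"
proof (rule inj_onI)
  fix s t assume st: "s \<in> edges H \<times> {..<M}" "t \<in> edges H \<times> {..<M}" "plant N \<iota> \<pi> s = plant N \<iota> \<pi> t"
  have "fst s \<noteq> {}" using st(1) by (auto elim: edgesE[OF H])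
  then show "s = t"
    using plant_eqD(1)[OF \<iota> \<pi> \<pi> slot_subset[OF st(1)] _ slot_subset[OF st(2)] st(3)] by blast
qed

lemma plant_in_nsets:
  assumes "s \<in> edges H \<times> {..<M}"
  shows "plant N \<iota> \<pi> s \<in> [{..<n}]\<^bsup>2\<^esup>"
proof -
  have "fst s \<in> edges H" using assms by auto
  then obtain u v where uv: "fst s = {u, v}" "u \<in> verts H" "v \<in> verts H" "u \<noteq> v"
    using edgesE[OF H] by blast
  define a where "a = snd s"
  have a: "a < M" using assms by (auto simp: a_def)
  have "plant N \<iota> \<pi> s = {spot N \<iota> \<pi> (u, a), spot N \<iota> \<pi> (v, a)}"
    by (simp add: plant_def uv(1) a_def)
  moreover have "spot N \<iota> \<pi> (u, a) \<noteq> spot N \<iota> \<pi> (v, a)"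
    using inj_onD[OF inj_spot, of "(u, a)" "(v, a)"] uv a by auto
  moreover have "spot N \<iota> \<pi> (u, a) < n" "spot N \<iota> \<pi> (v, a) < n"
    using uv a by (auto intro: spot_less)
  ultimately show ?thesis by simp
qed

lemma planted_copy_iso:
  assumes "a < M"
  shows "graph_iso H (planted_copy a)"
proof (rule graph_isoI[OF H, of "\<lambda>v. spot N \<iota> \<pi> (v, a)"])
  have "inj_on (\<lambda>v. spot N \<iota> \<pi> (v, a)) (verts H)"
  proof (rule inj_onI)
    fix u v assume "u \<in> verts H" "v \<in> verts H" "spot N \<iota> \<pi> (u, a) = spot N \<iota> \<pi> (v, a)"
    then show "u = v" using inj_onD[OF inj_spot, of "(u, a)" "(v, a)"] assms by auto
  qed
  then show "bij_betw (\<lambda>v. spot N \<iota> \<pi> (v, a)) (verts H) (verts (planted_copy a))"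
    unfolding bij_betw_def planted_copy_def by auto
  have "plant N \<iota> \<pi> (e, a) = (\<lambda>v. spot N \<iota> \<pi> (v, a)) ` e" for e
    by (auto simp: plant_def)
  then show "edges (planted_copy a) = (\<lambda>e. (\<lambda>v. spot N \<iota> \<pi> (v, a)) ` e) ` edges H"
    by (simp add: planted_copy_def)
qed

lemma planted_copy_in_copies:
  assumes "a < M"
  shows "planted_copy a \<in> copies n H"
proof -
  have "e \<in> [verts (planted_copy a)]\<^bsup>2\<^esup>" if e: "e \<in> edges (planted_copy a)" for e
  proof -
    obtain f where f: "f \<in> edges H" "e = plant N \<iota> \<pi> (f, a)"
      using e by (auto simp: planted_copy_def)
    then have "e \<in> [{..<n}]\<^bsup>2\<^esup>" using plant_in_nsets assms by auto
    moreover have "e \<subseteq> verts (planted_copy a)"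
      using f edges_subset_verts[OF H f(1)] by (auto simp: plant_def planted_copy_def)
    ultimately show ?thesis by (simp add: nsets_def)
  qed
  moreover have "finite (verts (planted_copy a))"
    using H by (simp add: planted_copy_def finite_simple_graph_def)
  ultimately have "finite_simple_graph (planted_copy a)"
    by (auto simp: finite_simple_graph_def)
  moreover have "verts (planted_copy a) \<subseteq> {..<n}"
    using assms by (auto simp: planted_copy_def intro!: spot_less)
  moreover have "edges (planted_copy a) \<subseteq> [{..<n}]\<^bsup>2\<^esup>"
    using assms plant_in_nsets by (auto simp: planted_copy_def)
  ultimately show ?thesis
    using graph_iso_sym[OF planted_copy_iso[OF assms]] by (simp add: copies_def subgraph_def)
qed

text \<open>By its number of edges, such an \<open>S\<close> consists of exactly one planted slot for each edge of \<open>H\<close>. Edges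
of different planted copies are disjoint, so connectedness puts all of them into the same copy. This
is where connectedness enters; for disconnected graphs, edges of different copies could combine.\<close>
lemma transversal_copy_is_planted:
  assumes es: "distinct es" "set es = edges H" and H2: "card (verts H) \<ge> 2" "connected_graph H"
    and S: "finite_simple_graph S" "connected_graph S" "card (verts S) \<ge> 2"
    and card: "card (edges S) \<le> length es"
    and hit: "\<And>j. j < length es \<Longrightarrow> \<exists>a<M. plant N \<iota> \<pi> (es ! j, a) \<in> edges S"
  shows "\<exists>a<M. S = planted_copy a"
proof -
  let ?p = "plant N \<iota> \<pi>"
  define c where "c = (\<lambda>j. SOME a. a < M \<and> ?p (es ! j, a) \<in> edges S)"
  have c: "c j < M \<and> ?p (es ! j, c j) \<in> edges S" if "j < length es" for j
    unfolding c_def using hit[OF that] by (rule someI_ex)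
  have esj: "es ! j \<in> edges H" if "j < length es" for j
    using nth_mem[OF that] es(2) by simp
  define B where "B = (\<lambda>j. ?p (es ! j, c j)) ` {..<length es}"
  have "inj_on (\<lambda>j. ?p (es ! j, c j)) {..<length es}"
  proof (rule inj_onI)
    fix i j assume ij: "i \<in> {..<length es}" "j \<in> {..<length es}" "?p (es ! i, c i) = ?p (es ! j, c j)"
    then have "(es ! i, c i) = (es ! j, c j)"
      by (intro inj_onD[OF inj_plant ij(3)]) (simp_all add: c esj)
    then show "i = j" using es(1) ij by (simp add: nth_eq_iff_index_eq)
  qed
  then have "card B = length es" by (simp add: B_def card_image)
  moreover have "B \<subseteq> edges S" using c by (auto simp: B_def)
  ultimately have BS: "edges S = B"
    using card card_seteq[OF finite_edges[OF S(1)], of B] by simp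
  \<comment> \<open>The index of the planted copy to which a vertex belongs; it is constant along edges of \<open>S\<close>.\<close>
  define \<beta> where "\<beta> = (\<lambda>w. snd (inv_into (verts H \<times> {..<M}) (spot N \<iota> \<pi>) w))"
  have \<beta>: "\<beta> w = c j" if w: "w \<in> ?p (es ! j, c j)" and j: "j < length es" for w j
  proof -
    obtain v where v: "v \<in> es ! j" "w = spot N \<iota> \<pi> (v, c j)"
      using w by (auto simp: plant_def)
    then have "(v, c j) \<in> verts H \<times> {..<M}"
      using c[OF j] edges_subset_verts[OF H esj[OF j]] by auto
    then show ?thesis unfolding \<beta>_def v(2) using inv_into_f_f[OF inj_spot] by simp
  qed
  have \<beta>_edge: "\<beta> x = \<beta> y" if "{x, y} \<in> edges S" for x y
  proof -
    from that obtain j where j: "j < length es" "{x, y} = ?p (es ! j, c j)"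
      unfolding BS B_def by auto
    have "x \<in> ?p (es ! j, c j)" "y \<in> ?p (es ! j, c j)" using j(2)[symmetric] by auto
    then show ?thesis using \<beta> j(1) by simp
  qed
  have "edges H \<noteq> {}" using Union_edges_connected[OF H H2(2,1)] H2(1) by auto
  then have pos: "0 < length es" using es(2) by auto
  have const: "c j = c 0" if j: "j < length es" for j
  proof -
    have "\<exists>w. w \<in> ?p (es ! j, c j) \<and> w \<in> verts S" if j: "j < length es" for j
    proof -
      have "?p (es ! j, c j) \<in> edges S" using c j by blast
      then obtain u v where "?p (es ! j, c j) = {u, v}" "u \<in> verts S"
        using edgesE[OF S(1)] by blast
      then show ?thesis by auto
    qed
    note ex = this
    obtain w where w: "w \<in> ?p (es ! j, c j)" "w \<in> verts S" using ex[OF j] by blast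
    obtain w' where w': "w' \<in> ?p (es ! 0, c 0)" "w' \<in> verts S" using ex[OF pos] by blast
    have "\<beta> w = \<beta> w'"
      by (rule connected_constant[where \<beta> = \<beta>, OF S(2) \<beta>_edge w(2) w'(2)])
    then show ?thesis using \<beta>[OF w(1) j] \<beta>[OF w'(1) pos] by simp
  qed
  have "edges S = (\<lambda>j. ?p (es ! j, c 0)) ` {..<length es}"
    unfolding BS B_def
  proof (rule image_cong[OF refl])
    fix j assume "j \<in> {..<length es}"
    then show "?p (es ! j, c j) = ?p (es ! j, c 0)" using const[of j] by (simp only: lessThan_iff)
  qed
  also have "\<dots> = (\<lambda>e. ?p (e, c 0)) ` (\<lambda>j. es ! j) ` {..<length es}"
    by (simp add: image_image)
  also have "(\<lambda>j. es ! j) ` {..<length es} = edges H"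
    using es(2) by (auto simp: set_conv_nth)
  finally have E: "edges S = edges (planted_copy (c 0))" by (simp add: planted_copy_def)
  have "verts S = \<Union> (edges S)" using Union_edges_connected[OF S] by simp
  also have "\<dots> = spot N \<iota> \<pi> ` (\<Union> (edges H) \<times> {c 0})"
    unfolding E planted_copy_def plant_def by auto
  also have "\<dots> = verts (planted_copy (c 0))"
    using Union_edges_connected[OF H H2(2,1)] by (simp add: planted_copy_def)
  finally have "S = planted_copy (c 0)" using E by (simp add: prod_eq_iff)
  then show ?thesis using c pos by blast
qed

text \<open>As \<open>R\<close> avoids the planted slots, the condition splits into one for the part outside and one for each
class of slots. This makes each monomial a product over the classes.\<close>
lemma copy_in_partial_plant_iff:
  assumes es: "distinct es" "set es = edges H"
    and xs: "set xs \<subseteq> Pow {..<M}" "length xs = length es"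
    and R: "R \<inter> plant N \<iota> \<pi> ` (edges H \<times> {..<M}) = {}"
  shows "E \<subseteq> R \<union> plant N \<iota> \<pi> ` slots es xs \<longleftrightarrow>
     E - plant N \<iota> \<pi> ` (edges H \<times> {..<M}) \<subseteq> R \<and>
     (\<forall>j<length es. {a \<in> {..<M}. plant N \<iota> \<pi> (es ! j, a) \<in> E} \<subseteq> xs ! j)"
proof -
  let ?p = "plant N \<iota> \<pi>" and ?F = "edges H \<times> {..<M}"
  have esj: "es ! j \<in> edges H" if "j < length es" for j
    using nth_mem[OF that] es(2) by simp
  have sub: "slots es xs \<subseteq> ?F" using slots_subset[OF xs] unfolding es(2) .
  show ?thesis
  proof (intro iffI conjI allI impI)
    assume E: "E \<subseteq> R \<union> ?p ` slots es xs"
    then show "E - ?p ` ?F \<subseteq> R" using sub by blast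
    fix j assume j: "j < length es"
    show "{a \<in> {..<M}. ?p (es ! j, a) \<in> E} \<subseteq> xs ! j"
    proof
      fix a assume "a \<in> {a \<in> {..<M}. ?p (es ! j, a) \<in> E}"
      then have a: "a < M" "?p (es ! j, a) \<in> E" by auto
      have inF: "(es ! j, a) \<in> ?F" using esj[OF j] a by auto
      then have "?p (es ! j, a) \<notin> R" using R by blast
      then obtain s where s: "s \<in> slots es xs" "?p (es ! j, a) = ?p s" using E a by blast
      then have "(es ! j, a) = s" using inj_onD[OF inj_plant s(2) inF] sub by blast
      then obtain j' where j': "j' < length es" "a \<in> xs ! j'" "es ! j = es ! j'"
        using s(1) by (auto simp: slots_def)
      then have "j = j'" using es(1) j by (simp add: nth_eq_iff_index_eq)
      then show "a \<in> xs ! j" using j' by simp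
    qed
  next
    assume *: "E - ?p ` ?F \<subseteq> R \<and> (\<forall>j<length es. {a \<in> {..<M}. ?p (es ! j, a) \<in> E} \<subseteq> xs ! j)"
    show "E \<subseteq> R \<union> ?p ` slots es xs"
    proof
      fix f assume f: "f \<in> E"
      show "f \<in> R \<union> ?p ` slots es xs"
      proof (cases "f \<in> ?p ` ?F")
        case True
        then obtain e a where ea: "e \<in> edges H" "a < M" "f = ?p (e, a)" by auto
        then have "e \<in> set es" using es(2) by simp
        then obtain j where j: "j < length es" "e = es ! j" unfolding in_set_conv_nth by blast
        then have "a \<in> xs ! j" using * f ea by blast
        then have "(e, a) \<in> slots es xs" using j by (auto simp: slots_def)
        then show ?thesis using ea(3) by blast
      qed (use * f in blast)
    qed
  qed
qed

end

text \<open>With the graph fixed outside the planted slots, the weighted count is a multilinear polynomial in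
the pattern. Its monomials are the potential copies, and those which meet every class are the
planted copies of \<open>G i0\<close>; no other \<open>G i\<close> is isomorphic to it.\<close>
lemma planted_phase_bound:
  fixes G :: "'i \<Rightarrow> 'a graph" and b :: "'i \<Rightarrow> int"
  assumes "planting (G i0) M N n \<iota> \<pi>" and I: "finite I" "i0 \<in> I"
    and G: "\<And>i. i \<in> I \<Longrightarrow> finite_simple_graph (G i) \<and> connected_graph (G i) \<and> card (verts (G i)) \<ge> 2"
    and max: "\<And>i. i \<in> I \<Longrightarrow> card (edges (G i)) \<le> card (edges (G i0))"
    and noniso: "\<And>i. i \<in> I \<Longrightarrow> i \<noteq> i0 \<Longrightarrow> \<not> graph_iso (G i0) (G i)"
    and es: "distinct es" "set es = edges (G i0)"
    and R: "R \<subseteq> [{..<n}]\<^bsup>2\<^esup> - plant N \<iota> \<pi> ` (edges (G i0) \<times> {..<M})"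
  shows "norm (mean {xs. set xs \<subseteq> Pow {..<M} \<and> length xs = length es}
           (\<lambda>xs. zeta q (\<Sum>i\<in>I. b i * int (num_copies ({..<n}, R \<union> plant N \<iota> \<pi> ` slots es xs) (G i)))))
             ^ (2 ^ length es)
       \<le> decay q (length es) (b i0) ^ M"
proof -
  interpret planting "G i0" M N n \<iota> \<pi> by fact
  let ?p = "plant N \<iota> \<pi>" and ?F = "edges (G i0) \<times> {..<M}"
  have G0: "connected_graph (G i0)" "card (verts (G i0)) \<ge> 2" using G[OF I(2)] by auto
  have esj: "es ! j \<in> edges (G i0)" if "j < length es" for j
    using nth_mem[OF that] es(2) by simp
  have len: "card (edges (G i0)) = length es" using es distinct_card by metis
  have "edges (G i0) \<noteq> {}" using Union_edges_connected[OF H G0] G0(2) by auto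
  then obtain m where m: "length es = Suc m" using es(2) by (cases es) auto
  define K where "K = (SIGMA i:I. copies n (G i))"
  define Y where "Y = (\<lambda>S j. {a \<in> {..<M}. ?p (es ! j, a) \<in> edges S})"
  define c where "c = (\<lambda>(i, S :: nat graph). b i * of_bool (edges S - ?p ` ?F \<subseteq> R))"
  define h :: "'i \<times> nat graph \<Rightarrow> nat \<Rightarrow> nat set \<Rightarrow> int"
    where "h = (\<lambda>(i, S) j x. of_bool (Y S j \<subseteq> x))"
  define \<kappa> where "\<kappa> = (\<lambda>a. (i0, planted_copy a))"
  have phase: "(\<Sum>i\<in>I. b i * int (num_copies ({..<n}, R \<union> ?p ` slots es xs) (G i)))
      = (\<Sum>k\<in>K. c k * (\<Prod>j<Suc m. h k j (xs ! j)))"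
    if xs: "set xs \<subseteq> Pow {..<M}" "length xs = length es" for xs
  proof -
    have disj: "R \<inter> ?p ` ?F = {}" using R by blast
    have "R \<union> ?p ` slots es xs \<subseteq> [{..<n}]\<^bsup>2\<^esup>"
    proof -
      have "slots es xs \<subseteq> ?F" using slots_subset[OF xs] unfolding es(2) .
      then show ?thesis using R plant_in_nsets by blast
    qed
    then have "(\<Sum>i\<in>I. b i * int (num_copies ({..<n}, R \<union> ?p ` slots es xs) (G i)))
        = (\<Sum>i\<in>I. \<Sum>S\<in>copies n (G i). b i * of_bool (edges S \<subseteq> R \<union> ?p ` slots es xs))"
      by (simp only: num_copies_eq_sum sum_distrib_left)
    also have "\<dots> = (\<Sum>(i, S)\<in>K. b i * of_bool (edges S \<subseteq> R \<union> ?p ` slots es xs))"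
      unfolding K_def by (intro sum.Sigma ballI finite_copies I)
    also have "\<dots> = (\<Sum>k\<in>K. c k * (\<Prod>j<Suc m. h k j (xs ! j)))"
    proof (rule sum.cong, goal_cases)
      case (2 k)
      obtain i S where k: "k = (i, S)" by (cases k)
      have "(\<Prod>j<Suc m. h k j (xs ! j)) = of_bool (\<forall>j<length es. Y S j \<subseteq> xs ! j)"
        unfolding k h_def m by (simp only: prod.case prod_of_bool finite_lessThan lessThan_iff Ball_def)
      moreover have "c k = b i * of_bool (edges S - ?p ` ?F \<subseteq> R)"
        by (simp add: k c_def)
      ultimately show ?case
        unfolding k prod.case copy_in_partial_plant_iff[OF es xs disj] Y_def[symmetric]
        by (simp only: of_bool_conj mult.assoc Y_def)
    qed simp
    finally show ?thesis .
  qed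
  have "mean {xs. set xs \<subseteq> Pow {..<M} \<and> length xs = length es}
           (\<lambda>xs. zeta q (\<Sum>i\<in>I. b i * int (num_copies ({..<n}, R \<union> ?p ` slots es xs) (G i))))
      = mean {xs. set xs \<subseteq> Pow {..<M} \<and> length xs = Suc m}
           (\<lambda>xs. zeta q (\<Sum>k\<in>K. c k * (\<Prod>j<Suc m. h k j (xs ! j))))"
    unfolding m by (rule mean_cong) (simp add: phase m)
  moreover have "norm (mean {xs. set xs \<subseteq> Pow {..<M} \<and> length xs = Suc m}
           (\<lambda>xs. zeta q (\<Sum>k\<in>K. c k * (\<Prod>j<Suc m. h k j (xs ! j))))) ^ (2 ^ Suc m)
       \<le> (\<Prod>a\<in>{..<M}. decay q (Suc m) (c (\<kappa> a)))"
  proof (rule multilinear_phase_bound)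
    show "finite K" unfolding K_def by (intro finite_SigmaI finite_copies I)
    show "\<kappa> ` {..<M} \<subseteq> K"
      using planted_copy_in_copies I(2) by (auto simp: K_def \<kappa>_def)
    show "inj_on \<kappa> {..<M}"
    proof (rule inj_onI)
      fix a a' assume a: "a \<in> {..<M}" "a' \<in> {..<M}" "\<kappa> a = \<kappa> a'"
      then have eq: "edges (planted_copy a) = edges (planted_copy a')" by (simp add: \<kappa>_def)
      have "es ! 0 \<in> edges (G i0)" using esj m by simp
      then have "?p (es ! 0, a) \<in> edges (planted_copy a')"
        unfolding eq[symmetric] by (simp add: planted_copy_def)
      then obtain e where "e \<in> edges (G i0)" "?p (es ! 0, a) = ?p (e, a')"
        by (auto simp: planted_copy_def)
      then show "a = a'"
        using inj_onD[OF inj_plant, of "(es ! 0, a)" "(e, a')"] a \<open>es ! 0 \<in> edges (G i0)\<close> by auto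
    qed
    fix a j x assume a: "a \<in> {..<M}" "j < Suc m" "x \<subseteq> {..<M}"
    have "Y (planted_copy a) j = {a}"
    proof -
      have ej: "es ! j \<in> edges (G i0)" using esj m a by simp
      have "a' = a" if a': "a' \<in> {..<M}" "?p (es ! j, a') \<in> edges (planted_copy a)" for a'
      proof -
        obtain e where "e \<in> edges (G i0)" "?p (es ! j, a') = ?p (e, a)"
          using a'(2) by (auto simp: planted_copy_def)
        then show ?thesis
          using inj_onD[OF inj_plant, of "(es ! j, a')" "(e, a)"] a a'(1) ej by auto
      qed
      moreover have "?p (es ! j, a) \<in> edges (planted_copy a)"
        using ej by (simp add: planted_copy_def)
      ultimately show ?thesis using a by (auto simp: Y_def)
    qed
    then show "h (\<kappa> a) j x = of_bool (a \<in> x)" by (simp add: h_def \<kappa>_def)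
  next
    fix k assume k: "k \<in> K - \<kappa> ` {..<M}"
    obtain i S where iS: "k = (i, S)" by (cases k)
    have i: "i \<in> I" and S: "S \<in> copies n (G i)" using k iS by (auto simp: K_def)
    have S1: "finite_simple_graph S" "graph_iso S (G i)" using S by (auto simp: copies_def subgraph_def)
    have S2: "connected_graph S" using connected_graph_iso[OF _ _ S1(2)] G[OF i] by blast
    obtain f where "bij_betw f (verts S) (verts (G i))" using S1(2) unfolding graph_iso_def by blast
    then have "card (verts S) = card (verts (G i))" by (rule bij_betw_same_card)
    then have S3: "card (verts S) \<ge> 2" using G[OF i] by simp
    have S4: "card (edges S) \<le> length es"
      using card_edges_iso[OF S1(1) _ S1(2)] G[OF i] max[OF i] len by simp
    show "c k = 0 \<or> (\<exists>j<Suc m. \<forall>x\<in>Pow {..<M}. \<forall>y\<in>Pow {..<M}. h k j x = h k j y)"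
    proof (rule ccontr)
      assume neg: "\<not> ?thesis"
      \<comment> \<open>A class that the copy does not meet contributes a factor that is constantly \<open>1\<close>.\<close>
      have hit: "\<exists>a<M. ?p (es ! j, a) \<in> edges S" if j: "j < length es" for j
      proof (rule ccontr)
        assume "\<not> (\<exists>a<M. ?p (es ! j, a) \<in> edges S)"
        then have "Y S j = {}" unfolding Y_def by blast
        then have "\<forall>x\<in>Pow {..<M}. \<forall>y\<in>Pow {..<M}. h k j x = h k j y" by (simp add: h_def iS)
        moreover have "j < Suc m" using j m by simp
        ultimately show False using neg by blast
      qed
      from transversal_copy_is_planted[OF es G0(2,1) S1(1) S2 S3 S4 hit]
      obtain a where a: "a < M" "S = planted_copy a" by blast
      have "graph_iso (G i0) S" unfolding a(2) by (rule planted_copy_iso[OF a(1)])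
      then have "graph_iso (G i0) (G i)" using S1(2) by (rule graph_iso_trans)
      then have "i = i0" using noniso i by blast
      then have "k = \<kappa> a" using iS a(2) by (simp add: \<kappa>_def)
      then show False using k a(1) by blast
    qed
  qed simp
  moreover have "c (\<kappa> a) = b i0" if "a \<in> {..<M}" for a
  proof -
    have "edges (planted_copy a) \<subseteq> ?p ` ?F" using that by (auto simp: planted_copy_def)
    then show ?thesis by (auto simp: c_def \<kappa>_def)
  qed
  ultimately show ?thesis by (simp add: m)
qed

section \<open>Equidistribution of the counts of sparse graphs\<close>

text \<open>The bound of the second moment method, with overlaps estimated as above, tends to
\<open>sqrt (1 * 1 - 1)\<close>.\<close>
lemma planting_error_tendsto_0:
  assumes H: "finite_simple_graph H" "\<alpha> > 0" "max_density H < inverse \<alpha>"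
    and T: "T \<subseteq> edges H \<times> {..<M::nat}" and u: "u > 0"
  shows "(\<lambda>n. sqrt (inverse (1 - real n powr (- \<alpha>)) ^ r *
      (\<Sum>D\<in>Pow (verts H \<times> {..<M}).
         inverse (real n powr (- \<alpha>)) ^ card {s \<in> T. fst s \<times> {snd s} \<subseteq> D} / real (n div u) ^ card D) - 1))
    \<longlonglongrightarrow> 0"
proof -
  have fin: "finite (verts H \<times> {..<M})" using H(1) by (simp add: finite_simple_graph_def)
  have emp: "{s \<in> T. fst s \<times> {snd s} \<subseteq> {}} = {}"
  proof -
    have "fst s \<noteq> {}" if "s \<in> T" for s
    proof -
      have "fst s \<in> edges H" using that T by auto
      then show ?thesis by (auto elim: edgesE[OF H(1)])
    qed
    then show ?thesis by auto
  qed
  have "(\<lambda>n. \<Sum>D\<in>Pow (verts H \<times> {..<M}).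
         inverse (real n powr (- \<alpha>)) ^ card {s \<in> T. fst s \<times> {snd s} \<subseteq> D} / real (n div u) ^ card D) \<longlonglongrightarrow> 1"
  proof (rule overlap_sum_tendsto[OF fin u])
    show "card {s \<in> T. fst s \<times> {snd s} \<subseteq> {}} = 0" by (simp only: emp card.empty)
    show "\<alpha> * real (card {s \<in> T. fst s \<times> {snd s} \<subseteq> D}) < real (card D)"
      if "D \<subseteq> verts H \<times> {..<M}" "D \<noteq> {}" for D
      by (rule slots_inside_less[OF H that T])
  qed
  moreover have "(\<lambda>n. inverse (1 - real n powr (- \<alpha>)) ^ r) \<longlonglongrightarrow> inverse (1 - 0) ^ r"
    using H(2)
    by (intro tendsto_power tendsto_inverse tendsto_diff tendsto_const tendsto_neg_powr
        filterlim_real_sequentially) auto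
  ultimately have "(\<lambda>n. sqrt (inverse (1 - real n powr (- \<alpha>)) ^ r *
      (\<Sum>D\<in>Pow (verts H \<times> {..<M}).
         inverse (real n powr (- \<alpha>)) ^ card {s \<in> T. fst s \<times> {snd s} \<subseteq> D} / real (n div u) ^ card D) - 1))
     \<longlonglongrightarrow> sqrt (inverse (1 - 0) ^ r * 1 - 1)"
    by (intro tendsto_real_sqrt tendsto_diff tendsto_mult tendsto_const)
  then show ?thesis by simp
qed

text \<open>The number \<open>M\<close> of planted copies is chosen so large that the bias over a random pattern is below
\<open>\<epsilon> / 2\<close>; it does not depend on \<open>n\<close>, so that the planting errors of the finitely many patterns
all tend to \<open>0\<close>.\<close>
lemma character_mean_tendsto_0:
  fixes G :: "'i \<Rightarrow> 'a graph" and b :: "'i \<Rightarrow> int"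
  assumes I: "finite I" "i0 \<in> I"
    and G: "\<And>i. i \<in> I \<Longrightarrow> finite_simple_graph (G i) \<and> connected_graph (G i) \<and> card (verts (G i)) \<ge> 2"
    and max: "\<And>i. i \<in> I \<Longrightarrow> card (edges (G i)) \<le> card (edges (G i0))"
    and noniso: "\<And>i. i \<in> I \<Longrightarrow> i \<noteq> i0 \<Longrightarrow> \<not> graph_iso (G i0) (G i)"
    and \<alpha>: "\<alpha> > 0" "max_density (G i0) < inverse \<alpha>"
    and q: "q > 0" "\<not> int q dvd b i0"
  shows "(\<lambda>n. rexp ([{..<n}]\<^bsup>2\<^esup>) (real n powr (- \<alpha>))
            (\<lambda>R. zeta q (\<Sum>i\<in>I. b i * int (num_copies ({..<n}, R) (G i))))) \<longlonglongrightarrow> 0"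
proof (rule tendstoI)
  fix \<epsilon> :: real assume \<epsilon>: "\<epsilon> > 0"
  have H: "finite_simple_graph (G i0)" and H2: "connected_graph (G i0)" "card (verts (G i0)) \<ge> 2"
    using G[OF I(2)] by auto
  obtain es where es: "distinct es" "set es = edges (G i0)"
    using finite_distinct_list[OF finite_edges[OF H]] by blast
  have "edges (G i0) \<noteq> {}" using Union_edges_connected[OF H H2] H2(2) by auto
  then have m: "length es > 0" using es(2) by auto
  define \<tau> where "\<tau> = decay q (length es) (b i0)"
  have \<tau>: "0 \<le> \<tau>" "\<tau> < 1"
    unfolding \<tau>_def by (rule decay_nonneg[OF m]) (rule decay_less_1[OF q])
  have "(\<epsilon> / 2) ^ (2 ^ length es) > 0" using \<epsilon> by simp
  then obtain M' where "\<tau> ^ M' < (\<epsilon> / 2) ^ (2 ^ length es)"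
    using real_arch_pow_inv[OF _ \<tau>(2)] by blast
  \<comment> \<open>The successor only ensures that at least one copy is planted.\<close>
  moreover define M where "M = Suc M'"
  moreover have "\<tau> ^ M \<le> \<tau> ^ M'" using \<tau> by (intro power_decreasing) (auto simp: M_def)
  ultimately have M: "M > 0" "\<tau> ^ M < (\<epsilon> / 2) ^ (2 ^ length es)" by auto
  define U where "U = verts (G i0) \<times> {..<M}"
  define F where "F = edges (G i0) \<times> {..<M}"
  define u where "u = card U"
  have U: "finite U" "U \<noteq> {}"
    using H H2 M(1) by (auto simp: U_def finite_simple_graph_def)
  then have u: "u > 0" by (simp add: u_def card_gt_0_iff)
  have F: "finite F" using finite_edges[OF H] by (simp add: F_def)
  obtain \<iota> where \<iota>: "bij_betw \<iota> U {0..<u}"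
    using ex_bij_betw_finite_nat[OF U(1)] unfolding u_def by blast
  define XS where "XS = {xs. set xs \<subseteq> Pow {..<M} \<and> length xs = length es}"
  have XS: "finite XS" "XS \<noteq> {}"
  proof -
    show "finite XS" unfolding XS_def by (intro finite_lists_length_eq) auto
    have "replicate (length es) {} \<in> XS" by (auto simp: XS_def)
    then show "XS \<noteq> {}" by blast
  qed
  have slotsF: "slots es xs \<subseteq> F" if "xs \<in> XS" for xs
    using slots_subset[of xs M es] that unfolding XS_def F_def es(2) by blast
  define err where "err = (\<lambda>xs n. sqrt (inverse (1 - real n powr (- \<alpha>)) ^ (2 * card (F - slots es xs)) *
      (\<Sum>D\<in>Pow U. inverse (real n powr (- \<alpha>)) ^ card {s \<in> slots es xs. fst s \<times> {snd s} \<subseteq> D}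
         / real (n div u) ^ card D) - 1))"
  have "(\<lambda>n. mean XS (\<lambda>xs. err xs n)) \<longlonglongrightarrow> (\<Sum>xs\<in>XS. 0) /\<^sub>R real (card XS)"
    unfolding mean_def
  proof (intro tendsto_scaleR tendsto_const tendsto_sum)
    fix xs assume "xs \<in> XS"
    from slotsF[OF this] show "(\<lambda>n. err xs n) \<longlonglongrightarrow> 0"
      unfolding err_def U_def F_def by (rule planting_error_tendsto_0[OF H \<alpha> _ u])
  qed
  then have "(\<lambda>n. mean XS (\<lambda>xs. err xs n)) \<longlonglongrightarrow> 0" by simp
  then have "eventually (\<lambda>n. mean XS (\<lambda>xs. err xs n) < \<epsilon> / 2) sequentially"
    by (rule order_tendstoD) (use \<epsilon> in simp)
  then show "eventually (\<lambda>n. dist (rexp ([{..<n}]\<^bsup>2\<^esup>) (real n powr (- \<alpha>))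
            (\<lambda>R. zeta q (\<Sum>i\<in>I. b i * int (num_copies ({..<n}, R) (G i))))) 0 < \<epsilon>) sequentially"
    using eventually_ge_at_top[of u] eventually_ge_at_top[of 2]
  proof eventually_elim
    case (elim n)
    define p where "p = real n powr (- \<alpha>)"
    have p: "0 < p" "p < 1"
    proof -
      show "0 < p" using elim by (simp add: p_def)
      have "real n powr (- \<alpha>) < real n powr 0" using elim \<alpha> by (intro powr_less_mono) auto
      then show "p < 1" using elim by (simp add: p_def)
    qed
    define P where "P = [{..<n}]\<^bsup>2\<^esup>"
    have P: "finite P" by (simp add: P_def finite_imp_finite_nsets)
    define N where "N = n div u"
    have N: "N > 0" using elim u by (simp add: N_def div_greater_zero_iff)
    define L where "L = placements U N"
    have L: "finite L" "L \<noteq> {}" using U N by (auto simp: L_def finite_PiE PiE_eq_empty_iff)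
    define \<Phi> where "\<Phi> = (\<lambda>R. zeta q (\<Sum>i\<in>I. b i * int (num_copies ({..<n}, R) (G i))))"
    let ?p = "plant N \<iota>"
    have pl: "planting (G i0) M N n \<iota> \<pi>" if \<pi>: "\<pi> \<in> L" for \<pi>
    proof
      show "finite_simple_graph (G i0)" by (rule H)
      show "inj_on \<iota> (verts (G i0) \<times> {..<M})" using \<iota> by (simp add: bij_betw_def U_def)
      show "\<pi> \<in> placements (verts (G i0) \<times> {..<M}) N" using \<pi> by (simp add: L_def U_def)
      fix x assume "x \<in> verts (G i0) \<times> {..<M}"
      then have "\<iota> x \<in> {0..<u}" using \<iota> unfolding U_def by (rule bij_betwE[THEN bspec, rotated])
      then have "(\<iota> x + 1) * N \<le> u * N" by (intro mult_right_mono) auto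
      also have "\<dots> \<le> n" unfolding N_def by simp
      finally show "\<iota> x * N + N \<le> n" by simp
    qed
    define Q where "Q = (\<lambda>xs \<pi>. rexp (P - ?p \<pi> ` F) p (\<lambda>R. \<Phi> (R \<union> ?p \<pi> ` slots es xs)))"
    have "norm (rexp P p \<Phi> - mean L (Q xs)) \<le> err xs n" if xs: "xs \<in> XS" for xs
    proof -
      have T: "slots es xs \<subseteq> F" by (rule slotsF[OF xs])
      have "norm (rexp P p \<Phi> - mean L (Q xs))
          \<le> sqrt (inverse (1 - p) ^ (2 * card (F - slots es xs)) *
            mean L (\<lambda>\<pi>. mean L (\<lambda>\<pi>'. inverse p ^ card (?p \<pi> ` slots es xs \<inter> ?p \<pi>' ` slots es xs))) - 1)"
        unfolding Q_def
      proof (rule planting_second_moment[OF P L F T _ _ p])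
        fix \<pi> assume "\<pi> \<in> L"
        then interpret planting "G i0" M N n \<iota> \<pi> by (rule pl)
        show "inj_on (?p \<pi>) F" unfolding F_def by (rule inj_plant)
        show "?p \<pi> ` F \<subseteq> P" using plant_in_nsets unfolding F_def P_def by blast
      qed (simp add: \<Phi>_def)
      also have "\<dots> \<le> err xs n"
        unfolding err_def p_def[symmetric]
      proof (intro real_sqrt_le_mono diff_right_mono mult_left_mono)
        have inE: "fst s \<in> edges (G i0) \<and> snd s < M" if "s \<in> slots es xs" for s
          using that T by (auto simp: F_def)
        show "mean L (\<lambda>\<pi>. mean L (\<lambda>\<pi>'. inverse p ^ card (?p \<pi> ` slots es xs \<inter> ?p \<pi>' ` slots es xs)))
            \<le> (\<Sum>D\<in>Pow U. inverse p ^ card {s \<in> slots es xs. fst s \<times> {snd s} \<subseteq> D} / real (n div u) ^ card D)"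
          unfolding L_def N_def[symmetric]
        proof (rule plant_overlap[OF U(1) _ N p])
          show "inj_on \<iota> U" using \<iota> by (simp add: bij_betw_def)
          show "finite (slots es xs)" using T F finite_subset by blast
          fix s assume s: "s \<in> slots es xs"
          have "fst s \<subseteq> verts (G i0)" using edges_subset_verts[OF H] inE[OF s] by blast
          then show "fst s \<times> {snd s} \<subseteq> U" using inE[OF s] by (auto simp: U_def)
          show "fst s \<noteq> {}" using inE[OF s] by (auto elim: edgesE[OF H])
        qed
        show "0 \<le> inverse (1 - p) ^ (2 * card (F - slots es xs))" using p by simp
      qed
      finally show ?thesis .
    qed
    then have "mean XS (\<lambda>xs. norm (rexp P p \<Phi> - mean L (Q xs))) \<le> mean XS (\<lambda>xs. err xs n)"
      by (rule mean_mono)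
    moreover have "rexp P p \<Phi> - mean XS (\<lambda>xs. mean L (Q xs)) = mean XS (\<lambda>xs. rexp P p \<Phi> - mean L (Q xs))"
      using XS by (simp add: mean_diff)
    ultimately have 1: "norm (rexp P p \<Phi> - mean XS (\<lambda>xs. mean L (Q xs))) \<le> mean XS (\<lambda>xs. err xs n)"
      using norm_mean_le order_trans by metis
    have "mean XS (\<lambda>xs. mean L (Q xs))
        = mean L (\<lambda>\<pi>. rexp (P - ?p \<pi> ` F) p (\<lambda>R. mean XS (\<lambda>xs. \<Phi> (R \<union> ?p \<pi> ` slots es xs))))"
      unfolding Q_def by (subst mean_swap) (simp only: mean_rexp)
    also have "norm \<dots> \<le> \<epsilon> / 2"
    proof (rule norm_mean_le_const)
      fix \<pi> assume \<pi>: "\<pi> \<in> L"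
      show "norm (rexp (P - ?p \<pi> ` F) p (\<lambda>R. mean XS (\<lambda>xs. \<Phi> (R \<union> ?p \<pi> ` slots es xs)))) \<le> \<epsilon> / 2"
      proof (rule norm_rexp_le_const)
        fix R assume R: "R \<subseteq> P - ?p \<pi> ` F"
        have "norm (mean XS (\<lambda>xs. \<Phi> (R \<union> ?p \<pi> ` slots es xs))) ^ (2 ^ length es) \<le> \<tau> ^ M"
          unfolding XS_def \<Phi>_def \<tau>_def
          by (rule planted_phase_bound[where G = G and ?i0.0 = i0,
                OF pl[OF \<pi>] I _ _ _ es R[unfolded P_def F_def]])
            (fact G max noniso)+
        also have "\<dots> < (\<epsilon> / 2) ^ (2 ^ length es)" by (rule M(2))
        finally have "norm (mean XS (\<lambda>xs. \<Phi> (R \<union> ?p \<pi> ` slots es xs))) < \<epsilon> / 2"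
          by (rule power_less_imp_less_base) (use \<epsilon> in simp)
        then show "norm (mean XS (\<lambda>xs. \<Phi> (R \<union> ?p \<pi> ` slots es xs))) \<le> \<epsilon> / 2" by simp
      qed (use P p in auto)
    qed (use \<epsilon> in simp)
    finally have 2: "norm (mean XS (\<lambda>xs. mean L (Q xs))) \<le> \<epsilon> / 2" .
    have "norm (rexp P p \<Phi>) \<le> norm (mean XS (\<lambda>xs. mean L (Q xs))) + norm (rexp P p \<Phi> - mean XS (\<lambda>xs. mean L (Q xs)))"
      by (rule norm_triangle_sub)
    then have "norm (rexp P p \<Phi>) < \<epsilon>" using 1 2 elim by linarith
    then show ?case by (simp add: P_def p_def \<Phi>_def)
  qed
qed

text \<open>Fourier inversion: the indicator of the residue vector \<open>a\<close> is an average of characters indexed by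
\<open>b\<close>. The trivial character yields the limit. For any other one, the graph to be planted is one with the
largest number of edges among those with a nonzero coefficient.\<close>
lemma joint_counts_equidistributed:
  fixes G :: "'i \<Rightarrow> 'a graph" and a :: "'i \<Rightarrow> nat"
  assumes I: "finite I"
    and G: "\<And>i. i \<in> I \<Longrightarrow> finite_simple_graph (G i) \<and> connected_graph (G i) \<and> card (verts (G i)) \<ge> 2"
    and noniso: "\<And>i j. i \<in> I \<Longrightarrow> j \<in> I \<Longrightarrow> i \<noteq> j \<Longrightarrow> \<not> graph_iso (G i) (G j)"
    and \<alpha>: "\<alpha> > 0" "\<And>i. i \<in> I \<Longrightarrow> max_density (G i) < inverse \<alpha>"
    and q: "q > 0" and a: "\<And>i. i \<in> I \<Longrightarrow> a i < q"
  shows "(\<lambda>n. rexp ([{..<n}]\<^bsup>2\<^esup>) (real n powr (- \<alpha>))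
            (\<lambda>R. of_bool (\<forall>i\<in>I. num_copies ({..<n}, R) (G i) mod q = a i)) :: real)
     \<longlonglongrightarrow> 1 / real q ^ card I"
proof -
  let ?B = "\<Pi>\<^sub>E i\<in>I. {..<q}"
  have finB: "finite ?B" using I by (intro finite_PiE) auto
  define ch where "ch = (\<lambda>(b :: 'i \<Rightarrow> nat) n. rexp ([{..<n}]\<^bsup>2\<^esup>) (real n powr (- \<alpha>))
            (\<lambda>R. zeta q (\<Sum>i\<in>I. int (b i) * int (num_copies ({..<n}, R) (G i)))))"
  define w where "w = (\<lambda>b :: 'i \<Rightarrow> nat. zeta q (- (\<Sum>i\<in>I. int (b i) * int (a i))))"
  define b0 where "b0 = (\<lambda>i\<in>I. 0 :: nat)"
  have b0: "b0 \<in> ?B" using q by (auto simp: b0_def)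
  have ind: "complex_of_real (of_bool (\<forall>i\<in>I. x i mod q = a i))
      = (\<Sum>b\<in>?B. w b * zeta q (\<Sum>i\<in>I. int (b i) * int (x i))) / of_nat q ^ card I" for x :: "'i \<Rightarrow> nat"
  proof -
    have one: "(\<Sum>b<q. zeta q (int b * (int (x i) - int (a i)))) / of_nat q = of_bool (x i mod q = a i)"
      if i: "i \<in> I" for i
    proof -
      have "int q dvd int (x i) - int (a i) \<longleftrightarrow> int (x i) mod int q = int (a i) mod int q"
        by (simp add: mod_eq_dvd_iff)
      also have "\<dots> \<longleftrightarrow> x i mod q = a i"
        using a[OF i] by (simp add: zmod_int[symmetric])
      finally show ?thesis using q by (simp add: sum_zeta_roots)
    qed
    have "complex_of_real (of_bool (\<forall>i\<in>I. x i mod q = a i)) = (\<Prod>i\<in>I. of_bool (x i mod q = a i))"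
      using I by (induction I rule: finite_induct) auto
    also have "\<dots> = (\<Prod>i\<in>I. (\<Sum>b<q. zeta q (int b * (int (x i) - int (a i)))) / of_nat q)"
      by (rule prod.cong) (simp_all add: one)
    also have "\<dots> = (\<Prod>i\<in>I. \<Sum>b<q. zeta q (int b * (int (x i) - int (a i)))) / of_nat q ^ card I"
      by (simp add: prod_dividef)
    also have "(\<Prod>i\<in>I. \<Sum>b<q. zeta q (int b * (int (x i) - int (a i))))
        = (\<Sum>b\<in>?B. \<Prod>i\<in>I. zeta q (int (b i) * (int (x i) - int (a i))))"
      using I by (intro prod_sum_PiE) auto
    also have "\<dots> = (\<Sum>b\<in>?B. w b * zeta q (\<Sum>i\<in>I. int (b i) * int (x i)))"
      unfolding w_def zeta_add[symmetric] zeta_sum[symmetric]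
      by (simp add: sum_subtractf algebra_simps)
    finally show ?thesis .
  qed
  have expand: "complex_of_real (rexp ([{..<n}]\<^bsup>2\<^esup>) (real n powr (- \<alpha>))
            (\<lambda>R. of_bool (\<forall>i\<in>I. num_copies ({..<n}, R) (G i) mod q = a i)))
      = (\<Sum>b\<in>?B. w b * ch b n) / of_nat q ^ card I" for n
  proof -
    have "complex_of_real (rexp ([{..<n}]\<^bsup>2\<^esup>) (real n powr (- \<alpha>))
            (\<lambda>R. of_bool (\<forall>i\<in>I. num_copies ({..<n}, R) (G i) mod q = a i)))
      = rexp ([{..<n}]\<^bsup>2\<^esup>) (real n powr (- \<alpha>))
            (\<lambda>R. complex_of_real (of_bool (\<forall>i\<in>I. num_copies ({..<n}, R) (G i) mod q = a i)))"
      by (simp add: rexp_def scaleR_conv_of_real)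
    also have "\<dots> = rexp ([{..<n}]\<^bsup>2\<^esup>) (real n powr (- \<alpha>))
       (\<lambda>R. inverse (of_nat q ^ card I) * (\<Sum>b\<in>?B. w b * zeta q (\<Sum>i\<in>I. int (b i) * int (num_copies ({..<n}, R) (G i)))))"
      unfolding ind by (simp only: divide_inverse mult.commute)
    also have "\<dots> = inverse (of_nat q ^ card I) * (\<Sum>b\<in>?B. w b * ch b n)"
      unfolding rexp_mult_right rexp_sum ch_def ..
    finally show ?thesis by (simp add: divide_inverse)
  qed
  have lim: "ch b \<longlonglongrightarrow> (if b = b0 then 1 else 0)" if b: "b \<in> ?B" for b
  proof (cases "b = b0")
    case True
    have "ch b0 = (\<lambda>n. 1)"
      by (rule ext) (simp add: ch_def b0_def finite_imp_finite_nsets)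
    then show ?thesis using True by simp
  next
    case False
    define I' where "I' = {i \<in> I. b i \<noteq> 0}"
    have I': "finite I'" "I' \<subseteq> I" using I by (auto simp: I'_def)
    have "I' \<noteq> {}"
    proof
      assume "I' = {}"
      then have "b = b0" using b by (intro ext) (auto simp: I'_def b0_def PiE_iff extensional_def)
      with False show False by simp
    qed
    then have "Max ((\<lambda>i. card (edges (G i))) ` I') \<in> (\<lambda>i. card (edges (G i))) ` I'"
      using I' by (intro Max_in) auto
    then obtain i0 where i0: "i0 \<in> I'" "card (edges (G i0)) = Max ((\<lambda>i. card (edges (G i))) ` I')"
      by auto
    have max: "card (edges (G i)) \<le> card (edges (G i0))" if "i \<in> I'" for i
      unfolding i0(2) using I' that by (intro Max_ge) auto
    have i0I: "i0 \<in> I" using i0 I' by blast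
    have "b i0 < q" using PiE_mem[OF b i0I] by simp
    moreover have "b i0 > 0" using i0(1) by (simp add: I'_def)
    ultimately have ndvd: "\<not> int q dvd int (b i0)" by (auto dest: zdvd_imp_le)
    have "ch b = (\<lambda>n. rexp ([{..<n}]\<^bsup>2\<^esup>) (real n powr (- \<alpha>))
            (\<lambda>R. zeta q (\<Sum>i\<in>I'. int (b i) * int (num_copies ({..<n}, R) (G i)))))"
    proof -
      have "(\<Sum>i\<in>I. int (b i) * f i) = (\<Sum>i\<in>I'. int (b i) * f i)" for f
        using I by (intro sum.mono_neutral_right) (auto simp: I'_def)
      then show ?thesis by (simp only: ch_def)
    qed
    moreover have "\<dots> \<longlonglongrightarrow> 0"
    proof (rule character_mean_tendsto_0[where G = G and ?i0.0 = i0 and b = "\<lambda>i. int (b i)", OF I'(1) i0(1) _ max _ \<alpha>(1) \<alpha>(2)[OF i0I] q ndvd])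
      show "finite_simple_graph (G i) \<and> connected_graph (G i) \<and> 2 \<le> card (verts (G i))" if "i \<in> I'" for i
        using G I'(2) that by blast
      show "\<not> graph_iso (G i0) (G i)" if "i \<in> I'" "i \<noteq> i0" for i
        using noniso[OF i0I, of i] I'(2) that by blast
    qed
    ultimately show ?thesis using False by simp
  qed
  have "w b0 = 1" by (simp add: w_def b0_def)
  have "(\<lambda>n. (\<Sum>b\<in>?B. w b * ch b n) / of_nat q ^ card I)
      \<longlonglongrightarrow> (\<Sum>b\<in>?B. w b * (if b = b0 then 1 else 0)) / of_nat q ^ card I"
    using q by (intro tendsto_intros lim) auto
  also have "(\<Sum>b\<in>?B. w b * (if b = b0 then 1 else 0)) = 1"
    using finB b0 \<open>w b0 = 1\<close> by (simp add: if_distrib sum.delta' cong: if_cong)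
  finally have "(\<lambda>n. complex_of_real (rexp ([{..<n}]\<^bsup>2\<^esup>) (real n powr (- \<alpha>))
            (\<lambda>R. of_bool (\<forall>i\<in>I. num_copies ({..<n}, R) (G i) mod q = a i))))
     \<longlonglongrightarrow> complex_of_real (1 / real q ^ card I)"
    unfolding expand by simp
  then show ?thesis by (simp only: tendsto_of_real_iff)
qed

section \<open>Absence of dense graphs\<close>

text \<open>First moment: a copy of \<open>H\<close> contains a copy of its densest subgraph \<open>H'\<close>, and the expected number of
embeddings of \<open>H'\<close>, with \<open>v\<close> vertices and \<open>e\<close> edges, is at most \<open>n\<close> to the negative power
\<open>v - \<alpha> * e\<close>.\<close>
lemma no_dense_copies:
  fixes H :: "'a graph"
  assumes H: "finite_simple_graph H" "verts H \<noteq> {}" and \<alpha>: "\<alpha> > 0" "max_density H > inverse \<alpha>"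
  shows "(\<lambda>n. rexp ([{..<n}]\<^bsup>2\<^esup>) (real n powr (- \<alpha>))
            (\<lambda>R. of_bool (num_copies ({..<n}, R) H \<noteq> 0)) :: real) \<longlonglongrightarrow> 0"
proof -
  obtain H' where H': "subgraph H' H" "card (verts H') > 0" "density H' = max_density H"
    using densest_subgraph[OF H] by blast
  define v e where "v = card (verts H')" and "e = card (edges H')"
  have "real e / real v > inverse \<alpha>" using H'(3) \<alpha>(2) by (simp add: density_def v_def e_def)
  then have neg: "real v - \<alpha> * real e < 0"
    using H'(2) \<alpha>(1) by (simp add: v_def[symmetric] field_simps)
  have fsg': "finite_simple_graph H'" and sub: "verts H' \<subseteq> verts H" "edges H' \<subseteq> edges H"
    using H'(1) by (auto simp: subgraph_def)
  have fV: "finite (verts H')" using fsg' by (simp add: finite_simple_graph_def)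
  show ?thesis
  proof (rule tendsto_sandwich[OF _ _ tendsto_const])
    show "(\<lambda>n. real n powr (real v - \<alpha> * real e)) \<longlonglongrightarrow> 0"
      using neg by (intro tendsto_neg_powr filterlim_real_sequentially)
    have p: "0 \<le> real n powr (- \<alpha>)" "real n powr (- \<alpha>) \<le> 1" if "n > 0" for n
    proof -
      have "real n powr (- \<alpha>) \<le> real n powr 0" using that \<alpha> by (intro powr_mono) auto
      then show "real n powr (- \<alpha>) \<le> 1" using that by simp
    qed simp
    show "\<forall>\<^sub>F n in sequentially. 0 \<le> rexp ([{..<n}]\<^bsup>2\<^esup>) (real n powr (- \<alpha>))
            (\<lambda>R. of_bool (num_copies ({..<n}, R) H \<noteq> 0) :: real)"
      using eventually_gt_at_top[of 0]
    proof eventually_elim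
      case (elim n)
      have "rexp ([{..<n}]\<^bsup>2\<^esup>) (real n powr (- \<alpha>)) (\<lambda>_. 0 :: real)
          \<le> rexp ([{..<n}]\<^bsup>2\<^esup>) (real n powr (- \<alpha>)) (\<lambda>R. of_bool (num_copies ({..<n}, R) H \<noteq> 0))"
        by (rule rexp_mono[OF p[OF elim]]) simp
      then show ?case by (simp add: finite_imp_finite_nsets)
    qed
    show "\<forall>\<^sub>F n in sequentially. rexp ([{..<n}]\<^bsup>2\<^esup>) (real n powr (- \<alpha>))
            (\<lambda>R. of_bool (num_copies ({..<n}, R) H \<noteq> 0) :: real) \<le> real n powr (real v - \<alpha> * real e)"
      using eventually_gt_at_top[of 0]
    proof eventually_elim
      case (elim n)
      define P where "P = [{..<n}]\<^bsup>2\<^esup>"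
      define p where "p = real n powr (- \<alpha>)"
      have P: "finite P" by (simp add: P_def finite_imp_finite_nsets)
      note p01 = p[OF elim, folded p_def]
      define Emb where "Emb = {\<sigma> \<in> (\<Pi>\<^sub>E x\<in>verts H'. {..<n}). inj_on \<sigma> (verts H')}"
      have fin: "finite (\<Pi>\<^sub>E x\<in>verts H'. {..<n})" using fV by (intro finite_PiE) auto
      have Emb: "finite Emb" using fin by (simp add: Emb_def)
      define im where "im = (\<lambda>\<sigma> :: 'a \<Rightarrow> nat. (\<lambda>e. \<sigma> ` e) ` edges H')"
      have "rexp P p (\<lambda>R. of_bool (num_copies ({..<n}, R) H \<noteq> 0) :: real)
          \<le> rexp P p (\<lambda>R. \<Sum>\<sigma>\<in>Emb. of_bool (im \<sigma> \<subseteq> R))"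
      proof (rule rexp_mono[OF p01])
        fix R assume R: "R \<subseteq> P"
        show "(of_bool (num_copies ({..<n}, R) H \<noteq> 0) :: real) \<le> (\<Sum>\<sigma>\<in>Emb. of_bool (im \<sigma> \<subseteq> R))"
        proof (cases "num_copies ({..<n}, R) H = 0")
          case True
          then show ?thesis by (simp add: sum_nonneg)
        next
          case False
          then have "{S. subgraph S ({..<n}, R) \<and> graph_iso S H} \<noteq> {}"
            by (metis num_copies_def card.empty)
          then obtain S where S: "subgraph S ({..<n}, R)" "graph_iso S H" by blast
          have fS: "finite_simple_graph S" "verts S \<subseteq> {..<n}" "edges S \<subseteq> R"
            using S(1) by (auto simp: subgraph_def)
          obtain f where f: "bij_betw f (verts H) (verts S)" "edges S = (\<lambda>e. f ` e) ` edges H"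
            using graph_isoE[OF H(1) fS(1) graph_iso_sym[OF S(2)]] by blast
          define \<sigma> where "\<sigma> = restrict f (verts H')"
          have "f x < n" if "x \<in> verts H'" for x
            using bij_betwE[OF f(1)] fS(2) sub(1) that by blast
          moreover have "inj_on f (verts H')" using f(1) sub(1) by (meson bij_betw_def inj_on_subset)
          ultimately have \<sigma>: "\<sigma> \<in> Emb"
            by (auto simp: Emb_def \<sigma>_def inj_on_restrict_eq)
          have "\<sigma> ` e = f ` e" if "e \<in> edges H'" for e
            unfolding \<sigma>_def using edges_subset_verts[OF fsg' that] by auto
          then have "im \<sigma> \<subseteq> edges S" unfolding im_def f(2) using sub(2) by auto
          then have "(of_bool (num_copies ({..<n}, R) H \<noteq> 0) :: real) = of_bool (im \<sigma> \<subseteq> R)"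
            using False fS(3) by auto
          also have "\<dots> \<le> (\<Sum>\<sigma>\<in>Emb. of_bool (im \<sigma> \<subseteq> R))"
            using \<sigma> Emb by (intro member_le_sum) auto
          finally show ?thesis .
        qed
      qed
      also have "\<dots> = (\<Sum>\<sigma>\<in>Emb. p ^ e)"
        unfolding rexp_sum
      proof (rule sum.cong[OF refl])
        fix \<sigma> assume \<sigma>: "\<sigma> \<in> Emb"
        have inj: "inj_on \<sigma> (verts H')" using \<sigma> by (simp add: Emb_def)
        have "im \<sigma> \<subseteq> P"
        proof
          fix f assume "f \<in> im \<sigma>"
          then obtain g where g: "g \<in> edges H'" "f = \<sigma> ` g" by (auto simp: im_def)
          obtain x y where xy: "g = {x, y}" "x \<in> verts H'" "y \<in> verts H'" "x \<noteq> y"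
            using edgesE[OF fsg' g(1)] by blast
          have "\<sigma> x \<noteq> \<sigma> y" using inj_onD[OF inj, of x y] xy by blast
          moreover have "\<sigma> x < n" "\<sigma> y < n" using \<sigma> xy by (auto simp: Emb_def PiE_iff)
          ultimately show "f \<in> P" using g xy by (simp add: P_def)
        qed
        moreover have "card (im \<sigma>) = e"
        proof -
          have "inj_on (\<lambda>e. \<sigma> ` e) (Pow (verts H'))" using inj by (rule inj_on_image_Pow)
          then have "inj_on (\<lambda>e. \<sigma> ` e) (edges H')"
            by (rule inj_on_subset) (use edges_subset_verts[OF fsg'] in blast)
          then show ?thesis by (simp add: im_def e_def card_image)
        qed
        ultimately show "rexp P p (\<lambda>R. of_bool (im \<sigma> \<subseteq> R)) = p ^ e"
          using rexp_superset[OF P, of "im \<sigma>" p] by simp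
      qed
      also have "\<dots> = real (card Emb) * p ^ e" by simp
      also have "\<dots> \<le> real (n ^ v) * p ^ e"
      proof -
        have "card Emb \<le> card (\<Pi>\<^sub>E x\<in>verts H'. {..<n})" using fin by (intro card_mono) (auto simp: Emb_def)
        also have "\<dots> = n ^ v" using fV by (simp add: card_PiE v_def)
        finally show ?thesis using p01 by (intro mult_right_mono of_nat_mono) auto
      qed
      also have "\<dots> = real n powr (real v - \<alpha> * real e)"
      proof -
        have "p ^ e = real n powr (- (\<alpha> * real e))"
          using elim by (simp add: p_def powr_powr[symmetric] powr_realpow[symmetric] powr_powr)
        moreover have "real (n ^ v) = real n powr real v" using elim by (simp add: powr_realpow)
        ultimately show ?thesis by (simp add: powr_add[symmetric])
      qed
      finally show ?case by (simp add: P_def p_def)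
    qed
  qed
qed

lemma max_density_rational:
  assumes "finite_simple_graph H" "verts H \<noteq> {}"
  shows "max_density H \<in> \<rat>"
  using densest_subgraph[OF assms] by (metis Rats_divide Rats_of_nat density_def)

section \<open>The limiting distribution\<close>

theorem corollary3:
  fixes q k :: nat and G :: "nat \<Rightarrow> 'a graph" and \<alpha> :: real
    and I J :: "nat set" and a :: "nat \<Rightarrow> nat"
  assumes "q > 1" and "k \<ge> 1"
    and "\<forall>i\<in>{1..k}. finite_simple_graph (G i) \<and> connected_graph (G i) \<and> card (verts (G i)) \<ge> 2"
    and "\<forall>i\<in>{1..k}. \<forall>j\<in>{1..k}. i \<noteq> j \<longrightarrow> \<not> graph_iso (G i) (G j)"
    and "\<alpha> > 0" and "\<alpha> \<notin> \<rat>"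
    and "I = {i \<in> {1..k}. max_density (G i) < inverse \<alpha>}"
    and "J = {1..k} - I"
    and "\<forall>i\<in>{1..k}. a i \<in> {0..<q}"
  shows "(\<lambda>n. measure_pmf.prob (random_graph n (real n powr (- \<alpha>)))
            {\<Gamma>. \<forall>i\<in>{1..k}. num_copies \<Gamma> (G i) mod q = a i})
         \<longlonglongrightarrow> (if \<forall>j\<in>J. a j = 0 then 1 / real q ^ card I else 0)"
proof -
  define \<E> :: "nat \<Rightarrow> (nat set set \<Rightarrow> real) \<Rightarrow> real"
    where "\<E> = (\<lambda>n. rexp ([{..<n}]\<^bsup>2\<^esup>) (real n powr (- \<alpha>)))"
  have p: "0 \<le> real n powr (- \<alpha>)" "real n powr (- \<alpha>) \<le> 1" for n
  proof -
    show "real n powr (- \<alpha>) \<le> 1"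
    proof (cases "n = 0")
      case False
      then have "real n powr (- \<alpha>) \<le> real n powr 0" using assms(5) by (intro powr_mono) auto
      then show ?thesis using False by simp
    qed simp
  qed simp
  have \<E>_mono: "\<E> n f \<le> \<E> n g" if "\<And>R. f R \<le> g R" for n f g
    unfolding \<E>_def by (rule rexp_mono[OF p that])
  have \<E>_0: "\<E> n (\<lambda>_. 0) = 0" for n
    by (simp add: \<E>_def finite_imp_finite_nsets)
  define X where "X = (\<lambda>(n :: nat) i R. num_copies ({..<n}, R) (G i))"
  define A where "A = (\<lambda>n. \<E> n (\<lambda>R. of_bool (\<forall>i\<in>{1..k}. X n i R mod q = a i)))"
  have prob: "(\<lambda>n. measure_pmf.prob (random_graph n (real n powr (- \<alpha>)))
            {\<Gamma>. \<forall>i\<in>{1..k}. num_copies \<Gamma> (G i) mod q = a i}) = A"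
    by (rule ext) (simp only: prob_random_graph[OF p] A_def \<E>_def X_def)
  \<comment> \<open>Irrationality of \<open>\<alpha>\<close> excludes the critical density, at which the expected number of copies of a densest subgraph neither vanishes nor diverges.\<close>
  have J0: "(\<lambda>n. \<E> n (\<lambda>R. of_bool (X n j R \<noteq> 0))) \<longlonglongrightarrow> 0" if j: "j \<in> J" for j
  proof -
    have jk: "j \<in> {1..k}" and ge: "max_density (G j) \<ge> inverse \<alpha>" using j assms(7,8) by auto
    have "finite_simple_graph (G j) \<and> card (verts (G j)) \<ge> 2" using assms(3) jk by blast
    then have Gj: "finite_simple_graph (G j)" "verts (G j) \<noteq> {}" by auto
    have "inverse \<alpha> \<notin> \<rat>" using assms(6) Rats_inverse[of "inverse \<alpha>"] by auto
    then have "max_density (G j) > inverse \<alpha>"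
      using ge max_density_rational[OF Gj] by (cases "max_density (G j) = inverse \<alpha>") auto
    then show ?thesis unfolding \<E>_def X_def by (rule no_dense_copies[OF Gj assms(5)])
  qed
  have "A \<longlonglongrightarrow> (if \<forall>j\<in>J. a j = 0 then 1 / real q ^ card I else 0)"
  proof (cases "\<forall>j\<in>J. a j = 0")
    case False
    then obtain j where j: "j \<in> J" "a j \<noteq> 0" by blast
    have jk: "j \<in> {1..k}" using j assms(8) by blast
    have "A \<longlonglongrightarrow> 0"
    proof (rule tendsto_sandwich[OF _ _ tendsto_const J0[OF j(1)]])
      have "\<E> n (\<lambda>_. 0) \<le> A n" for n
        unfolding A_def by (rule \<E>_mono) simp
      then show "\<forall>\<^sub>F n in sequentially. 0 \<le> A n"
        by (simp add: \<E>_0)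
      have "A n \<le> \<E> n (\<lambda>R. of_bool (X n j R \<noteq> 0))" for n
        unfolding A_def
      proof (rule \<E>_mono)
        fix R
        have "X n j R \<noteq> 0" if "\<forall>i\<in>{1..k}. X n i R mod q = a i"
        proof
          assume "X n j R = 0"
          then have "a j = 0" using that[rule_format, OF jk] by simp
          with j(2) show False by simp
        qed
        then show "(of_bool (\<forall>i\<in>{1..k}. X n i R mod q = a i) :: real) \<le> of_bool (X n j R \<noteq> 0)"
          by simp
      qed
      then show "\<forall>\<^sub>F n in sequentially. A n \<le> \<E> n (\<lambda>R. of_bool (X n j R \<noteq> 0))"
        by simp
    qed
    then show ?thesis unfolding if_not_P[OF False] .
  next
    case True
    define B where "B = (\<lambda>n. \<E> n (\<lambda>R. of_bool (\<forall>i\<in>I. X n i R mod q = a i)))"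
    define C where "C = (\<lambda>n. \<Sum>j\<in>J. \<E> n (\<lambda>R. of_bool (X n j R \<noteq> 0)))"
    have IJ: "{1..k} = I \<union> J" "finite I" "finite J" using assms(7,8) by auto
    have B: "B \<longlonglongrightarrow> 1 / real q ^ card I"
      unfolding B_def \<E>_def X_def
    proof (rule joint_counts_equidistributed[OF IJ(2)])
      fix i assume "i \<in> I"
      then have i: "i \<in> {1..k}" "max_density (G i) < inverse \<alpha>" unfolding assms(7) by blast+
      show "finite_simple_graph (G i) \<and> connected_graph (G i) \<and> card (verts (G i)) \<ge> 2"
        using assms(3) i(1) by blast
      show "max_density (G i) < inverse \<alpha>" by (rule i(2))
      show "a i < q" using assms(9) i(1) by simp
      fix j assume "j \<in> I" "i \<noteq> j"
      moreover have "j \<in> {1..k}" using \<open>j \<in> I\<close> unfolding assms(7) by blast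
      ultimately show "\<not> graph_iso (G i) (G j)" using assms(4) i(1) by blast
    qed (use assms(1,5) in auto)
    have "C \<longlonglongrightarrow> (\<Sum>j\<in>J. 0)"
      unfolding C_def by (intro tendsto_sum J0)
    then have C: "C \<longlonglongrightarrow> 0" by simp
    have AB: "A n \<le> B n" for n
      unfolding A_def B_def
    proof (rule \<E>_mono)
      fix R
      have "I \<subseteq> {1..k}" using IJ(1) by blast
      then show "(of_bool (\<forall>i\<in>{1..k}. X n i R mod q = a i) :: real)
          \<le> of_bool (\<forall>i\<in>I. X n i R mod q = a i)"
        by auto
    qed
    have BCA: "B n - C n \<le> A n" for n
    proof -
      have "B n \<le> \<E> n (\<lambda>R. of_bool (\<forall>i\<in>{1..k}. X n i R mod q = a i) + (\<Sum>j\<in>J. of_bool (X n j R \<noteq> 0)))"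
        unfolding B_def
      proof (rule \<E>_mono)
        fix R
        show "(of_bool (\<forall>i\<in>I. X n i R mod q = a i) :: real)
            \<le> of_bool (\<forall>i\<in>{1..k}. X n i R mod q = a i) + (\<Sum>j\<in>J. of_bool (X n j R \<noteq> 0))"
        proof (cases "\<exists>j\<in>J. X n j R \<noteq> 0")
          case j: True
          then obtain j where "j \<in> J" "X n j R \<noteq> 0" by blast
          then have "(1 :: real) \<le> (\<Sum>j\<in>J. of_bool (X n j R \<noteq> 0))"
            using member_le_sum[of j J "\<lambda>j. of_bool (X n j R \<noteq> 0) :: real"] IJ(3) by simp
          moreover have "(of_bool (\<forall>i\<in>I. X n i R mod q = a i) :: real) \<le> 1"
            "(0 :: real) \<le> of_bool (\<forall>i\<in>{1..k}. X n i R mod q = a i)"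
            by (simp_all only: of_bool_less_eq_one zero_less_eq_of_bool)
          ultimately show ?thesis by linarith
        next
          case False
          have J: "X n j R mod q = a j" if "j \<in> J" for j
          proof -
            have "X n j R = 0" using False that by blast
            then show ?thesis using True that by simp
          qed
          have "(\<forall>i\<in>{1..k}. X n i R mod q = a i) \<longleftrightarrow> (\<forall>i\<in>I. X n i R mod q = a i)"
            unfolding IJ(1) using J by blast
          then have "(of_bool (\<forall>i\<in>{1..k}. X n i R mod q = a i) :: real) = of_bool (\<forall>i\<in>I. X n i R mod q = a i)"
            by (rule arg_cong)
          moreover have "(0 :: real) \<le> (\<Sum>j\<in>J. of_bool (X n j R \<noteq> 0))"
            by (rule sum_nonneg) simp
          ultimately show ?thesis by linarith
        qed
      qed
      also have "\<dots> = A n + C n"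
        unfolding A_def C_def \<E>_def by (simp only: rexp_add rexp_sum)
      finally show ?thesis by simp
    qed
    have BC: "(\<lambda>n. B n - C n) \<longlonglongrightarrow> 1 / real q ^ card I"
      using tendsto_diff[OF B C] by simp
    have "A \<longlonglongrightarrow> 1 / real q ^ card I"
    proof (rule tendsto_sandwich[OF _ _ BC B])
      show "\<forall>\<^sub>F n in sequentially. B n - C n \<le> A n" by (rule always_eventually) (rule allI, rule BCA)
      show "\<forall>\<^sub>F n in sequentially. A n \<le> B n" by (rule always_eventually) (rule allI, rule AB)
    qed
    then show ?thesis unfolding if_P[OF True] .
  qed
  then show ?thesis by (simp only: prob)
qed

end
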